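(* Let $n\ge 3$ and let $P_1,\ldots,P_n$ be the (consecutive) vertices of a regular $n$-gon inscribed in the unit circle with center $O$. Let $\Gamma$ be a circle of positive radius with center $O$, and for each $i$ let $B_i$ be the intersection point of the ray $OP_i$ with $\Gamma$. For $X\in\Gamma$ and $\lambda\in\mathbb{R}$ put $R_n(X,\lambda)=\sum_{i=1}^n XP_i^{\lambda}$. (1) Let $\lambda<0$. The minimum of $R_n(X,\lambda)$ over $X\in\Gamma$ is achieved when $X$ bisects the arc between consecutive vertices of $B_1\ldots B_n$, and the maximum is achieved when $X=B_i$ for some $i$; in the case when $\Gamma$ is the circumscribed circle of $P_1\ldots P_n$, the function $R_n(\cdot,\lambda)$ is instead not bounded above (as $X\to B_i$ for some $i$). (2) Let $0\le\lambda<2n$. If $\lambda$ is an even integer, then $R_n(X,\lambda)$ is independent of the position of $X$ on $\Gamma$. Otherwise, let $m$ be the integer such that $2m\le\lambda\le 2m+2$. If $m$ is even, then $R_n(X,\lambda)$ is maximal over $X\in\Gamma$ if and only if $X$ bisects the arc between consecutive vertices of $B_1\ldots B_n$, and is minimal if and only if $X=B_i$ for some $i$. If $m$ is odd, then $R_n(X,\lambda)$ is minimal over $X\in\Gamma$ if and only if $X$ bisects the arc between consecutive vertices of $B_1\ldots B_n$, and is maximal if and only if $X=B_i$ for some $i$. (3) Let $\lambda\ge 2n$. If $n$ is even, the maximum of $R_n(X,\lambda)$ over $X\in\Gamma$ is obtained when $X$ coincides with one of the vertices of $B_1\ldots B_n$, and the minimum is achieved when $X$ bisects the arc between consecutive vertices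 of $B_1\ldots B_n$. If $n$ is odd, the minimum of $R_n(X,\lambda)$ over $X\in\Gamma$ is obtained when $X$ coincides with one of the vertices of $B_1\ldots B_n$, and the maximum is achieved when $X$ bisects the arc between consecutive vertices of $B_1\ldots B_n$.
   Context: $XP_i$ denotes the Euclidean distance between $X$ and $P_i$, and $XP_i^\lambda$ means $(XP_i)^\lambda$. The points $B_1,\ldots,B_n$ form a regular $n$-gon inscribed in $\Gamma$; "$X$ bisects the arc between consecutive vertices of $B_1\ldots B_n$" means that $X$ is the midpoint of one of the $n$ short arcs of $\Gamma$ between neighbouring points $B_i,B_{i+1}$ (indices modulo $n$). When $\Gamma$ is the unit circle and $\lambda<0$, $R_n(X,\lambda)$ is considered only for $X\notin\{P_1,\ldots,P_n\}$ (equivalently it is $+\infty$ at these points). For $\lambda=0$, $0^0=1$. *)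

theory Defs
  imports "HOL-Analysis.Analysis"
begin

text \<open>
  The Euclidean plane is modelled by \<^typ>\<open>complex\<close>. The vertices are listed consecutively,
  with indices \<open>1, \<dots>, n\<close>, in counterclockwise (\<open>\<epsilon> = 1\<close>) or clockwise (\<open>\<epsilon> = -1\<close>) order.
\<close>

definition regular_ngon :: "nat \<Rightarrow> complex \<Rightarrow> real \<Rightarrow> (nat \<Rightarrow> complex) \<Rightarrow> bool" where
  "regular_ngon n c r P \<longleftrightarrow>
     (\<exists>\<theta>::real. \<exists>\<epsilon>\<in>{1, -1::real}. \<forall>i\<in>{1..n}.
        P i = c + of_real r * cis (\<theta> + \<epsilon> * (2 * pi * real i / real n)))"

definition ray :: "complex \<Rightarrow> complex \<Rightarrow> complex set" where
  "ray c p = {c + of_real t * (p - c) |t::real. 0 \<le> t}"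

text \<open>
  For two points \<open>A\<close>, \<open>B\<close> that are not antipodal on the circle with center \<open>c\<close> and radius \<open>\<rho>\<close>,
  choose polar angles differing by less than \<open>\<pi>\<close>: the short arc consists of the points whose angle
  lies between them, and its midpoint is the point at the mean angle.
\<close>

definition short_arc_midpoint ::
    "complex \<Rightarrow> real \<Rightarrow> complex \<Rightarrow> complex \<Rightarrow> complex \<Rightarrow> bool" where
  "short_arc_midpoint c \<rho> A B X \<longleftrightarrow>
     (\<exists>\<alpha> \<beta>::real. \<bar>\<beta> - \<alpha>\<bar> < pi \<and>
        A = c + of_real \<rho> * cis \<alpha> \<and> B = c + of_real \<rho> * cis \<beta> \<and>
        X = c + of_real \<rho> * cis ((\<alpha> + \<beta>) / 2))"

text \<open>The successor of \<open>i\<close> in the cyclic order of \<open>{1..n}\<close> is \<open>i mod n + 1\<close>.\<close>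

definition bisects_consecutive_arc ::
    "nat \<Rightarrow> complex \<Rightarrow> real \<Rightarrow> (nat \<Rightarrow> complex) \<Rightarrow> complex \<Rightarrow> bool" where
  "bisects_consecutive_arc n c \<rho> B X \<longleftrightarrow>
     (\<exists>i\<in>{1..n}. short_arc_midpoint c \<rho> (B i) (B (i mod n + 1)) X)"

text \<open>
  Powers of distances with the convention \<open>0\<^sup>0 = 1\<close>, whereas \<^term>\<open>0 powr 0 = (0::real)\<close>.
  For \<open>a < 0\<close> the value at \<open>x = 0\<close> is the junk value 0, so points at distance 0 have to be
  excluded wherever negative exponents are used.
\<close>

definition dist_power :: "real \<Rightarrow> real \<Rightarrow> real" where
  "dist_power x a = (if a = 0 then 1 else x powr a)"

definition R :: "nat \<Rightarrow> (nat \<Rightarrow> complex) \<Rightarrow> real \<Rightarrow> complex \<Rightarrow> real" where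
  "R n P a X = (\<Sum>i=1..n. dist_power (dist X (P i)) a)"

end

theory Submission
  imports Defs
begin

text \<open>
  Put \<open>f x = (1 + \<rho>\<^sup>2 - 2 \<rho> x)\<^sup>s\<close> with \<open>s = a/2\<close>. If the direction of \<open>X\<close> makes the angle \<open>\<phi>\<close> with
  a vertex, then by the law of cosines \<open>R n P a X\<close> is \<open>F \<phi> = \<Sum>\<^sub>k f (cos t\<^sub>k)\<close> with
  \<open>t\<^sub>k = \<phi> + 2\<pi>k/n\<close>. This function is even and has period \<open>2\<pi>/n\<close>, so it depends on \<open>cos (n \<phi>)\<close> only;
  the points \<open>B\<^sub>i\<close> are those with \<open>cos (n \<phi>) = 1\<close> and the midpoints of the arcs those with
  \<open>cos (n \<phi>) = -1\<close>. Everything follows once \<open>F\<close> is known to be strictly monotone, or constant, on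
  \<open>[0, \<pi>/n]\<close>, with a direction that can be read off from \<open>s\<close>.

  The derivative is \<open>F' \<phi> = -\<Sum>\<^sub>k f' (cos t\<^sub>k) sin t\<^sub>k\<close>. For \<open>0 < \<phi> < \<pi>/n\<close> the \<open>n\<close> nodes \<open>cos t\<^sub>k\<close> are
  distinct, so \<open>f'\<close> may be replaced by the polynomial \<open>q\<close> of degree less than \<open>n\<close> that agrees with it at
  the nodes. The sums \<open>\<Sum>\<^sub>k cos\<^sup>j t\<^sub>k sin t\<^sub>k\<close> vanish for \<open>j < n - 1\<close>, because no frequency divisible
  by \<open>n\<close> occurs, and equal \<open>n sin (n \<phi>) / 2\<^sup>n\<^sup>-\<^sup>1\<close> for \<open>j = n - 1\<close>. Only the leading coefficient of \<open>q\<close>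
  remains. It is the divided difference of \<open>f'\<close> at the nodes, hence \<open>f\<^sup>(\<^sup>n\<^sup>) \<xi> / (n - 1)!\<close> for some
  \<open>\<xi>\<close> in the open interval \<open>(-1, 1)\<close> by repeated use of Rolle's theorem, and so
  \<open>F' \<phi> = - n sin (n \<phi>) f\<^sup>(\<^sup>n\<^sup>) \<xi> / (2\<^sup>n\<^sup>-\<^sup>1 (n - 1)!)\<close>; see \<open>DERIV_sum_equally_spaced\<close> and
  \<open>root_sum_diff\<close>.

  Finally \<open>f\<^sup>(\<^sup>n\<^sup>) x = (2\<rho>)\<^sup>n (0 - s) (1 - s) \<dots> (n - 1 - s) (1 + \<rho>\<^sup>2 - 2 \<rho> x)\<^sup>s\<^sup>-\<^sup>n\<close> has constant sign on
  \<open>(-1, 1)\<close>. The product is positive for \<open>s < 0\<close>, has the sign \<open>(-1)\<^sup>m\<^sup>+\<^sup>1\<close> for \<open>m < s < m + 1 \<le> n\<close> and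
  the sign \<open>(-1)\<^sup>n\<close> for \<open>s > n - 1\<close>, and it vanishes for \<open>s = 0, 1, \<dots>, n - 1\<close>: these are the cases
  of the theorem. For \<open>a < 0\<close> and \<open>\<rho> = 1\<close> the function \<open>f\<close> is singular at \<open>1\<close>; the argument still
  compares any two points that are not vertices.
\<close>

section \<open>Divided differences and the mean value theorem\<close>

lemma interpolating_poly_exists:
  fixes g :: "real \<Rightarrow> real"
  assumes "finite Z" and "card Z = Suc m"
  shows "\<exists>q. degree q \<le> m \<and> (\<forall>z\<in>Z. poly q z = g z)"
  using assms
proof (induction m arbitrary: Z)
  case 0
  then obtain z where "Z = {z}"
    using card_1_singletonE by auto
  then show ?case
    by (intro exI[of _ "[:g z:]"]) auto
next
  case (Suc m)
  then obtain z Y where Z: "Z = insert z Y" "z \<notin> Y" and Y: "card Y = Suc m" "finite Y"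
    by (metis card_Suc_eq finite_insert)
  obtain q where q: "degree q \<le> m" "\<forall>y\<in>Y. poly q y = g y"
    using Suc.IH Y by blast
  \<comment> \<open>Newton's step: a multiple of \<open>N\<close> corrects the value at \<open>z\<close> and vanishes on \<open>Y\<close>.\<close>
  define N where "N = (\<Prod>y\<in>Y. [:-y, 1:])"
  have poly_N: "poly N x = (\<Prod>y\<in>Y. x - y)" for x
    by (simp add: N_def poly_prod)
  have "degree N \<le> (\<Sum>y\<in>Y. degree [:-y, 1:])"
    unfolding N_def by (rule order.trans[OF degree_prod_sum_le[OF Y(2)]]) simp
  then have deg_N: "degree N \<le> Suc m"
    using Y by simp
  have "poly N z \<noteq> 0"
    using Z(2) Y(2) by (auto simp: poly_N)
  define c where "c = (g z - poly q z) / poly N z"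
  have "degree (q + smult c N) \<le> Suc m"
    using q(1) deg_N by (intro degree_add_le) (auto intro: order.trans[OF degree_smult_le])
  moreover have "poly (q + smult c N) y = g y" if "y \<in> Z" for y
  proof (cases "y = z")
    case True
    then show ?thesis
      using \<open>poly N z \<noteq> 0\<close> by (simp add: c_def)
  next
    case False
    then have "y \<in> Y"
      using that Z by blast
    then have "poly N y = 0"
      using Y(2) by (auto simp: poly_N)
    then show ?thesis
      using q(2) \<open>y \<in> Y\<close> by simp
  qed
  ultimately show ?case
    by blast
qed

text \<open>
  The bound \<open>Z' \<subseteq> {..<Max Z}\<close> is what makes the induction work: the zero which Rolle's theorem
  yields between the two largest elements of \<open>Z\<close> lies to the right of all the earlier ones.
\<close>

lemma Rolle_zeros:
  fixes f f' :: "real \<Rightarrow> real"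
  assumes "finite Z" and "card Z = Suc m" and "Z \<subseteq> I" and I: "is_interval I"
    and df: "\<And>x. x \<in> I \<Longrightarrow> (f has_real_derivative f' x) (at x)"
    and "\<And>z. z \<in> Z \<Longrightarrow> f z = 0"
  shows "\<exists>Z'. finite Z' \<and> card Z' = m \<and> Z' \<subseteq> I \<inter> {..<Max Z} \<and> (\<forall>z\<in>Z'. f' z = 0)"
  using assms(1-3,6)
proof (induction m arbitrary: Z)
  case 0
  show ?case
    by (intro exI[of _ "{}"]) auto
next
  case (Suc m)
  define b Y a where "b = Max Z" and "Y = Z - {b}" and "a = Max Y"
  have "Z \<noteq> {}"
    using Suc.prems(2) by auto
  then have b: "b \<in> Z"
    using Suc.prems(1) by (simp add: b_def)
  have Y: "finite Y" "card Y = Suc m" "Y \<subseteq> I"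
    using Suc.prems b by (auto simp: Y_def)
  then have "Y \<noteq> {}"
    by auto
  then have a: "a \<in> Y"
    using Y by (simp add: a_def)
  have "a \<le> b"
    using a Suc.prems(1) by (simp add: Y_def b_def)
  then have ab: "a < b"
    using a by (auto simp: Y_def)
  obtain Z' where Z': "finite Z'" "card Z' = m" "Z' \<subseteq> I \<inter> {..<a}" "\<forall>z\<in>Z'. f' z = 0"
    using Suc.IH[OF Y] Suc.prems(4) unfolding a_def Y_def by blast
  have sub: "{a..b} \<subseteq> I"
  proof
    fix x assume "x \<in> {a..b}"
    moreover have "a \<in> I" "b \<in> I"
      using a b Y(3) Suc.prems(3) by auto
    ultimately show "x \<in> I"
      using I unfolding is_interval_1 by (metis atLeastAtMost_iff)
  qed
  have "\<exists>l z. a < z \<and> z < b \<and> DERIV f z :> l \<and> f b - f a = (b - a) * l"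
  proof (rule MVT[OF ab])
    show "continuous_on {a..b} f"
      by (rule DERIV_continuous_on[of _ _ f']) (use df sub has_field_derivative_at_within in blast)
    show "f differentiable (at x)" if "a < x" "x < b" for x
          proof -
      have "x \<in> I"
        using sub that by auto
      then show ?thesis
        using df real_differentiable_def by blast
    qed
  qed
  moreover have "f a = 0" "f b = 0"
    using a b Suc.prems(4) by (auto simp: Y_def)
  ultimately obtain z where z: "a < z" "z < b" "DERIV f z :> 0"
    using ab by auto
  have "z \<in> I"
    using z sub by auto
  then have "f' z = 0"
    using z(3) df DERIV_unique by blast
  show ?case
  proof (intro exI[of _ "insert z Z'"] conjI)
    have "z \<notin> Z'"
      using Z' z by force
    then show "card (insert z Z') = Suc m"
      using Z' by simp
    show "insert z Z' \<subseteq> I \<inter> {..<Max Z}"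
      using Z' z ab \<open>z \<in> I\<close> unfolding b_def[symmetric] by force
  qed (use Z' \<open>f' z = 0\<close> in auto)
qed

lemma higher_Rolle:
  fixes F :: "nat \<Rightarrow> real \<Rightarrow> real"
  assumes "finite Z" and "card Z = Suc m" and "Z \<subseteq> I" and I: "is_interval I"
    and "\<And>j x. x \<in> I \<Longrightarrow> (F j has_real_derivative F (Suc j) x) (at x)"
    and "\<And>z. z \<in> Z \<Longrightarrow> F 0 z = 0"
  shows "\<exists>\<xi>\<in>I. F m \<xi> = 0"
  using assms(1-3,5,6)
proof (induction m arbitrary: Z F)
  case 0
  then obtain z where "z \<in> Z"
    by (metis card_1_singletonE insertI1 One_nat_def)
  then show ?case
    using 0 by blast
next
  case (Suc m)
  obtain Z' where "finite Z'" "card Z' = Suc m" "Z' \<subseteq> I" "\<forall>z\<in>Z'. F 1 z = 0"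
    using Rolle_zeros[OF Suc.prems(1-3) I, of "F 0" "F 1"] Suc.prems(4,5) by auto
  then show ?case
    using Suc.IH[of Z' "\<lambda>j. F (Suc j)"] Suc.prems(4) by auto
qed

text \<open>
  The leading coefficient of the interpolating polynomial is the divided difference of the
  interpolated function, so this is the mean value theorem for divided differences.
\<close>

lemma interpolating_poly_lead_coeff:
  fixes G :: "nat \<Rightarrow> real \<Rightarrow> real"
  assumes "finite Z" and "card Z = Suc m" and "Z \<subseteq> I" and "is_interval I"
    and dG: "\<And>j x. x \<in> I \<Longrightarrow> (G j has_real_derivative G (Suc j) x) (at x)"
    and q: "degree q \<le> m" "\<And>z. z \<in> Z \<Longrightarrow> poly q z = G 0 z"
  shows "\<exists>\<xi>\<in>I. fact m * coeff q m = G m \<xi>"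
proof -
  define F where "F = (\<lambda>j x. G j x - poly ((pderiv ^^ j) q) x)"
  have "(F j has_real_derivative F (Suc j) x) (at x)" if "x \<in> I" for j x
    unfolding F_def by (auto intro!: derivative_eq_intros dG[OF that] poly_DERIV)
  then obtain \<xi> where \<xi>: "\<xi> \<in> I" "F m \<xi> = 0"
    using higher_Rolle[OF assms(1-4), of F] q(2) by (auto simp: F_def)
  have "degree ((pderiv ^^ m) q) = 0"
    using q(1) by (simp add: degree_higher_pderiv)
  then obtain a where "(pderiv ^^ m) q = [:a:]"
    by (rule degree_eq_zeroE)
  then have "poly ((pderiv ^^ m) q) \<xi> = coeff ((pderiv ^^ m) q) 0"
    by simp
  also have "\<dots> = fact m * coeff q m"
    by (simp add: coeff_higher_pderiv pochhammer_fact)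
  finally show ?thesis
    using \<xi> by (intro bexI[of _ \<xi>]) (simp_all add: F_def)
qed

section \<open>Trigonometric sums over equally spaced angles\<close>

text \<open>The sum is the imaginary part of a geometric series whose ratio is an \<open>n\<close>-th root of unity.\<close>

lemma sum_sin_equally_spaced:
  assumes "n > 0"
  shows "(\<Sum>k=1..n. sin (real l * (\<phi> + 2 * pi * real k / real n))) =
    (if n dvd l then real n * sin (real l * \<phi>) else 0)"
proof -
  define w where "w = cis (2 * pi * real l / real n)"
  have "w ^ n = cis (real n * (2 * pi * real l / real n))"
    by (simp only: w_def Complex.DeMoivre)
  also have "real n * (2 * pi * real l / real n) = 2 * pi * real l"
    using assms by simp
  finally have wn: "w ^ n = 1"
    by (simp add: cis_multiple_2pi)
  have term_eq: "sin (real l * (\<phi> + 2 * pi * real k / real n)) = Im (cis (real l * \<phi>) * w ^ k)" for k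
  proof -
    have "cis (real l * \<phi>) * w ^ k = cis (real l * (\<phi> + 2 * pi * real k / real n))"
      by (simp add: w_def Complex.DeMoivre cis_mult algebra_simps)
    then show ?thesis
      by simp
  qed
  have w1: "w = 1 \<longleftrightarrow> n dvd l"
  proof
    assume "w = 1"
    then have "cos (2 * pi * real l / real n) = 1"
      by (simp add: w_def complex_eq_iff)
    then obtain j :: int where "2 * pi * real l / real n = of_int j * 2 * pi"
      using cos_one_2pi_int by blast
    then have "real l = real_of_int j * real n"
      using assms by (simp add: field_simps)
    then have "real_of_int (int l) = real_of_int (j * int n)"
      by simp
    then have "int l = j * int n"
      by (simp only: of_int_eq_iff)
    then show "n dvd l"
      by (metis dvd_triv_right int_dvd_int_iff)
  next
    assume "n dvd l"
    then obtain j where "l = n * j" ..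
    then have "2 * pi * real l / real n = 2 * pi * real j"
      using assms by simp
    then show "w = 1"
      by (simp only: w_def) (simp add: cis_multiple_2pi)
  qed
  have "(\<Sum>k=1..n. w ^ k) = (if n dvd l then of_nat n else 0)"
  proof (cases "w = 1")
    case True
    then show ?thesis
      using w1 by simp
  next
    case False
    then have "(\<Sum>k<n. w ^ k) = 0"
      using wn by (simp add: sum_gp_strict)
    moreover have "(\<Sum>k=1..n. w ^ k) = (\<Sum>k<n. w ^ Suc k)"
      by (rule sum.reindex_bij_witness[of _ Suc "\<lambda>k. k - 1"]) auto
    ultimately show ?thesis
      using False w1 by (simp add: sum_distrib_left[symmetric])
  qed
  then have "(\<Sum>k=1..n. Im (cis (real l * \<phi>) * w ^ k)) =
      Im (cis (real l * \<phi>) * (if n dvd l then of_nat n else 0))"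
    by (simp add: Im_sum[symmetric] sum_distrib_left[symmetric] del: Im_sum times_complex.sel)
  then show ?thesis
    by (simp add: term_eq)
qed

text \<open>
  Expanding \<open>cos\<^sup>j x sin (l x)\<close> into sines of multiples of \<open>x\<close>, the only frequency divisible by
  \<open>n\<close> that can occur is \<open>j + l = n\<close>; it comes with the coefficient \<open>1 / 2\<^sup>j\<close>.
\<close>

lemma sum_cos_power_sin_equally_spaced:
  assumes "1 \<le> l" and "j + l \<le> n"
  shows "(\<Sum>k=1..n. cos (\<phi> + 2 * pi * real k / real n) ^ j *
      sin (real l * (\<phi> + 2 * pi * real k / real n))) =
    (if j + l = n then real n * sin (real n * \<phi>) / 2 ^ j else 0)"
  using assms
proof (induction j arbitrary: l)
  case 0
  then have "n dvd l \<longleftrightarrow> l = n"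
    by (auto dest: dvd_imp_le)
  then show ?case
    using 0 sum_sin_equally_spaced[of n l \<phi>] by auto
next
  case (Suc j)
  define t where "t = (\<lambda>k. \<phi> + 2 * pi * real k / real n)"
  have split: "cos x ^ Suc j * sin (real l * x) =
      (cos x ^ j * sin (real (Suc l) * x) + cos x ^ j * sin (real (l - 1) * x)) / 2" for x :: real
  proof -
    have "real l * x + x = real (Suc l) * x" "real l * x - x = real (l - 1) * x"
      using \<open>1 \<le> l\<close> by (simp_all add: algebra_simps of_nat_diff)
    then have "sin (real l * x) * cos x = (sin (real (Suc l) * x) + sin (real (l - 1) * x)) / 2"
      by (simp only: sin_times_cos)
    moreover have "cos x ^ Suc j * sin (real l * x) = cos x ^ j * (sin (real l * x) * cos x)"
      by (simp only: power_Suc mult_ac)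
    ultimately show ?thesis
      by (simp only: distrib_left times_divide_eq_right)
  qed
  have up: "(\<Sum>k=1..n. cos (t k) ^ j * sin (real (Suc l) * t k)) =
      (if Suc j + l = n then real n * sin (real n * \<phi>) / 2 ^ j else 0)"
    using Suc.IH[of "Suc l"] Suc.prems by (simp add: t_def)
  have down: "(\<Sum>k=1..n. cos (t k) ^ j * sin (real (l - 1) * t k)) = 0"
  proof (cases "l = 1")
    case False
    then show ?thesis
      using Suc.IH[of "l - 1"] Suc.prems by (simp add: t_def)
  qed simp
  have "(\<Sum>k=1..n. cos (t k) ^ Suc j * sin (real l * t k)) =
      ((\<Sum>k=1..n. cos (t k) ^ j * sin (real (Suc l) * t k)) +
       (\<Sum>k=1..n. cos (t k) ^ j * sin (real (l - 1) * t k))) / 2"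
    unfolding split by (simp add: sum.distrib sum_divide_distrib[symmetric])
  also have "\<dots> = (if Suc j + l = n then real n * sin (real n * \<phi>) / 2 ^ Suc j else 0)"
    unfolding up down by simp
  finally show ?case
    unfolding t_def .
qed

lemma sum_poly_cos_sin_equally_spaced:
  assumes "degree q \<le> m" and "n = Suc m"
  shows "(\<Sum>k=1..n. poly q (cos (\<phi> + 2 * pi * real k / real n)) *
      sin (\<phi> + 2 * pi * real k / real n)) =
    coeff q m * real n * sin (real n * \<phi>) / 2 ^ m"
proof -
  define t where "t = (\<lambda>k. \<phi> + 2 * pi * real k / real n)"
  have poly_q: "poly q x = (\<Sum>j\<le>m. coeff q j * x ^ j)" for x
  proof -
    have "poly q x = poly (\<Sum>j\<le>m. monom (coeff q j) j) x"
      using assms(1) by (simp only: poly_as_sum_of_monoms')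
    then show ?thesis
      by (simp add: poly_sum poly_monom)
  qed
  have "(\<Sum>k=1..n. poly q (cos (t k)) * sin (t k)) =
      (\<Sum>k=1..n. \<Sum>j\<le>m. coeff q j * (cos (t k) ^ j * sin (t k)))"
    by (simp add: poly_q sum_distrib_right mult.assoc)
  also have "\<dots> = (\<Sum>j\<le>m. coeff q j * (\<Sum>k=1..n. cos (t k) ^ j * sin (t k)))"
    by (subst sum.swap) (simp add: sum_distrib_left)
  also have "\<dots> = (\<Sum>j\<le>m. if j = m then coeff q j * (real n * sin (real n * \<phi>) / 2 ^ m) else 0)"
  proof (rule sum.cong)
    fix j assume "j \<in> {..m}"
    then show "coeff q j * (\<Sum>k=1..n. cos (t k) ^ j * sin (t k)) =
        (if j = m then coeff q j * (real n * sin (real n * \<phi>) / 2 ^ m) else 0)"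
      using sum_cos_power_sin_equally_spaced[of 1 j n \<phi>] assms(2) by (auto simp: t_def)
  qed simp
  finally show ?thesis
    by (simp add: t_def)
qed

text \<open>
  Distinct angles of the family with the same cosine are opposite modulo \<open>2\<pi>\<close>, which forces
  \<open>n \<phi>\<close> to be a multiple of \<open>\<pi>\<close>.
\<close>

lemma inj_on_cos_equally_spaced:
  assumes "n > 0" and "sin (real n * \<phi>) \<noteq> 0"
  shows "inj_on (\<lambda>k. cos (\<phi> + 2 * pi * real k / real n)) {1..n}"
proof (rule inj_onI)
  fix i j
  assume ij: "i \<in> {1..n}" "j \<in> {1..n}"
    and "cos (\<phi> + 2 * pi * real i / real n) = cos (\<phi> + 2 * pi * real j / real n)"
  then obtain r where "r \<in> \<int>" and
    r: "\<phi> + 2 * pi * real i / real n = \<phi> + 2 * pi * real j / real n + 2 * r * pi \<or>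
     \<phi> + 2 * pi * real i / real n = - (\<phi> + 2 * pi * real j / real n) + 2 * r * pi"
    unfolding cos_eq by blast
  from \<open>r \<in> \<int>\<close> obtain k :: int where "r = of_int k"
    by (rule Ints_cases)
  with r have angles:
    "\<phi> + 2 * pi * real i / real n = \<phi> + 2 * pi * real j / real n + 2 * real_of_int k * pi \<or>
     \<phi> + 2 * pi * real i / real n = - (\<phi> + 2 * pi * real j / real n) + 2 * real_of_int k * pi"
    by simp
  define x y where "x = real i / real n" and "y = real j / real n"
  have xy: "real i = x * real n" "real j = y * real n"
    using assms(1) by (simp_all add: x_def y_def)
  from angles show "i = j"
  proof
    assume e: "\<phi> + 2 * pi * real i / real n = \<phi> + 2 * pi * real j / real n + 2 * real_of_int k * pi"
    have "2 * pi * (x - y - of_int k) = 0"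
      using e by (simp add: x_def y_def right_diff_distrib)
    then have "x = y + of_int k"
      by simp
    then have "real i = real j + of_int k * real n"
      unfolding xy by (simp add: distrib_right)
    then have "real_of_int (int i) = real_of_int (int j + k * int n)"
      by simp
    then have eq: "int i = int j + k * int n"
      by (simp only: of_int_eq_iff)
    have "\<bar>k * int n\<bar> < int n"
      using ij eq by auto
    then have "k = 0"
      using dvd_imp_le_int[of "k * int n" "int n"] assms(1) by fastforce
    then show ?thesis
      using eq by simp
  next
    assume e: "\<phi> + 2 * pi * real i / real n = - (\<phi> + 2 * pi * real j / real n) + 2 * real_of_int k * pi"
    have "2 * pi * real i / real n = 2 * (x * pi)" "2 * pi * real j / real n = 2 * (y * pi)"
      by (simp_all add: x_def y_def)
    with e have \<phi>: "\<phi> = (of_int k - x - y) * pi"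
      by (simp only:) (simp add: left_diff_distrib)
    have "real n * \<phi> = of_int (k * int n - int i - int j) * pi"
      unfolding \<phi> by (simp add: xy algebra_simps)
    then have "sin (real n * \<phi>) = 0"
      unfolding sin_zero_iff_int2 by blast
    then show ?thesis
      using assms(2) by simp
  qed
qed

section \<open>Sums over the \<open>n\<close>-th roots of a point of the unit circle\<close>

text \<open>
  For \<open>v = e\<^sup>i\<^sup>n\<^sup>\<phi>\<close> this is the sum of \<open>f (cos t)\<close> over the \<open>n\<close> angles \<open>t = \<phi> + 2\<pi>k/n\<close>. Indexing it by \<open>v\<close>
  builds in the invariance under \<open>\<phi> \<mapsto> \<phi> + 2\<pi>/n\<close>.
\<close>

definition root_sum :: "nat \<Rightarrow> (real \<Rightarrow> real) \<Rightarrow> complex \<Rightarrow> real" where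
  "root_sum n f v = (\<Sum>z | z ^ n = v. f (Re z))"

lemma root_sum_cnj: "root_sum n f (cnj v) = root_sum n f v"
  unfolding root_sum_def
proof (rule sum.reindex_bij_witness[of _ cnj cnj])
  show "cnj z \<in> {z. z ^ n = v}" if "z \<in> {z. z ^ n = cnj v}" for z
  proof -
    have "cnj z ^ n = cnj (z ^ n)"
      by simp
    also have "\<dots> = v"
      using that by (simp del: complex_cnj_power)
    finally show ?thesis
      by simp
  qed
qed auto

lemma root_sum_cong_Re:
  assumes "cmod v = cmod w" and "Re v = Re w"
  shows "root_sum n f v = root_sum n f w"
proof -
  have "(Im v)\<^sup>2 = (Im w)\<^sup>2"
    using assms cmod_power2[of v] cmod_power2[of w] by simp
  then have "v = w \<or> v = cnj w"
    using assms(2) by (auto simp: complex_eq_iff power2_eq_iff)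
  then show ?thesis
    using root_sum_cnj by auto
qed

lemma cis_equally_spaced_power:
  assumes "n > 0" and "\<epsilon> \<in> {1, -1::real}"
  shows "cis (\<epsilon> * (2 * pi * real k / real n)) ^ n = 1"
proof -
  have "cis (\<epsilon> * (2 * pi * real k / real n)) ^ n = cis (real n * (\<epsilon> * (2 * pi * real k / real n)))"
    by (simp only: Complex.DeMoivre)
  also have "real n * (\<epsilon> * (2 * pi * real k / real n)) = 2 * pi * (\<epsilon> * real k)"
    using assms(1) by simp
  also have "cis \<dots> = 1"
    using assms(2) by (intro cis_multiple_2pi) auto
  finally show ?thesis .
qed

lemma bij_betw_cis_equally_spaced:
  assumes n: "n > 0" and \<epsilon>: "\<epsilon> \<in> {1, -1::real}"
  shows "bij_betw (\<lambda>k. cis (\<epsilon> * (2 * pi * real k / real n))) {1..n} {w. w ^ n = 1}"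
    (is "bij_betw ?g _ _")
proof -
  have "w \<in> ?g ` {1..n}" if "w ^ n = 1" for w
  proof -
    have "w \<in> (\<lambda>k. cis (2 * pi * real k / real n)) ` {..<n}"
      using that unfolding bij_betw_imp_surj_on[OF Complex.bij_betw_roots_unity[OF n]] by simp
    then obtain k where k: "k < n" "w = cis (2 * pi * real k / real n)"
      by auto
    show ?thesis
    proof (cases "\<epsilon> = 1 \<and> k > 0")
      case True
      then show ?thesis
        using k by auto
    next
      case False
      have "w = ?g (n - k)"
      proof (cases "\<epsilon> = 1")
        case True
        then show ?thesis
          using False k n by simp
      next
        case False
        have "\<epsilon> * (2 * pi * real (n - k) / real n) = 2 * pi * real k / real n - 2 * pi"
          using False \<epsilon> k n by (simp add: of_nat_diff field_simps)
        then show ?thesis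
          using k by (simp add: cis_divide[symmetric] del: mult_minus_left)
      qed
      then show ?thesis
        by (rule image_eqI) (use k in auto)
    qed
  qed
  then have "?g ` {1..n} = {w. w ^ n = 1}"
    using cis_equally_spaced_power[OF assms] by auto
  moreover from this have "inj_on ?g {1..n}"
    using card_roots_unity_eq[OF n] by (intro eq_card_imp_inj_on) auto
  ultimately show ?thesis
    by (simp add: bij_betw_def)
qed

lemma root_sum_power:
  assumes "n > 0" and "\<epsilon> \<in> {1, -1::real}" and "u \<noteq> 0"
  shows "root_sum n f (u ^ n) = (\<Sum>k=1..n. f (Re (u * cis (\<epsilon> * (2 * pi * real k / real n)))))"
proof -
  have "root_sum n f (u ^ n) = (\<Sum>w | w ^ n = 1. f (Re (u * w)))"
    unfolding root_sum_def
    by (rule sum.reindex_bij_witness[of _ "\<lambda>w. u * w" "\<lambda>z. z / u"])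
       (use assms(3) in \<open>auto simp: power_divide power_mult_distrib\<close>)
  also have "\<dots> = (\<Sum>k=1..n. f (Re (u * cis (\<epsilon> * (2 * pi * real k / real n)))))"
    by (rule sum.reindex_bij_betw[symmetric]) (rule bij_betw_cis_equally_spaced[OF assms(1,2)])
  finally show ?thesis .
qed

lemma root_sum_cis:
  assumes "n > 0"
  shows "root_sum n f (cis (real n * \<phi>)) = (\<Sum>k=1..n. f (cos (\<phi> + 2 * pi * real k / real n)))"
proof -
  have "root_sum n f (cis \<phi> ^ n) =
      (\<Sum>k=1..n. f (Re (cis \<phi> * cis (1 * (2 * pi * real k / real n)))))"
    using assms by (intro root_sum_power) auto
  then show ?thesis
    by (simp add: Complex.DeMoivre cis_mult)
qed

text \<open>
  By the chain rule the derivative is \<open>-\<Sum> f' (cos t\<^sub>k) sin t\<^sub>k\<close>. Replacing \<open>f'\<close> by its interpolating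
  polynomial at the nodes \<open>cos t\<^sub>k\<close> does not change this sum; only the leading coefficient of that
  polynomial contributes, and the mean value theorem expresses it by the \<open>n\<close>-th derivative of \<open>f\<close>.
\<close>

lemma DERIV_sum_equally_spaced:
  fixes D :: "nat \<Rightarrow> real \<Rightarrow> real"
  assumes n: "n = Suc m" and sin: "sin (real n * \<phi>) \<noteq> 0"
    and dD: "\<And>j x. x \<in> {-1<..<1} \<Longrightarrow> (D j has_real_derivative D (Suc j) x) (at x)"
  shows "\<exists>\<xi>\<in>{-1<..<1}. ((\<lambda>\<phi>. \<Sum>k=1..n. D 0 (cos (\<phi> + 2 * pi * real k / real n)))
    has_real_derivative - (real n * sin (real n * \<phi>) / (2 ^ m * fact m)) * D n \<xi>) (at \<phi>)"
proof -
  define t where "t = (\<lambda>k. \<phi> + 2 * pi * real k / real n)"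
  define Z where "Z = (\<lambda>k. cos (t k)) ` {1..n}"
  have "sin (t k) \<noteq> 0" for k
  proof
    assume "sin (t k) = 0"
    then obtain i :: int where "t k = of_int i * pi"
      unfolding sin_zero_iff_int2 by blast
    then have "real n * \<phi> = of_int (int n * i - 2 * int k) * pi"
      using n by (simp add: t_def field_simps)
    then show False
      using sin unfolding sin_zero_iff_int2 by blast
  qed
  then have cos_t: "cos (t k) \<in> {-1<..<1}" for k
    using sin_cos_squared_add[of "t k"] abs_square_less_1[of "cos (t k)"]
    by (smt (verit) greaterThanLessThan_iff zero_less_power2)
  have Z: "finite Z" "card Z = Suc m" "Z \<subseteq> {-1<..<1}"
    using inj_on_cos_equally_spaced[OF _ sin] cos_t n
    by (auto simp: Z_def t_def card_image)
  obtain q where q: "degree q \<le> m" "\<forall>z\<in>Z. poly q z = D 1 z"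
    using interpolating_poly_exists[OF Z(1,2), of "D 1"] by blast
  obtain \<xi> where \<xi>: "\<xi> \<in> {-1<..<1}" "fact m * coeff q m = D (Suc m) \<xi>"
    using interpolating_poly_lead_coeff[OF Z, of "\<lambda>j. D (Suc j)" q] dD q
    by (auto simp: is_interval_oo)
  have "((\<lambda>\<phi>. \<Sum>k=1..n. D 0 (cos (\<phi> + 2 * pi * real k / real n))) has_real_derivative
      (\<Sum>k=1..n. D 1 (cos (t k)) * - sin (t k))) (at \<phi>)"
  proof (rule DERIV_sum)
    fix k
    have "((\<lambda>\<phi>. cos (\<phi> + 2 * pi * real k / real n)) has_real_derivative - sin (t k)) (at \<phi>)"
      unfolding t_def by (auto intro!: derivative_eq_intros)
    moreover have "(D 0 has_real_derivative D 1 (cos (t k))) (at (cos (\<phi> + 2 * pi * real k / real n)))"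
      using dD[OF cos_t, of 0 k] by (simp add: t_def)
    ultimately show "((\<lambda>\<phi>. D 0 (cos (\<phi> + 2 * pi * real k / real n))) has_real_derivative
        D 1 (cos (t k)) * - sin (t k)) (at \<phi>)"
      by (rule DERIV_chain2[rotated])
  qed
  also have "(\<Sum>k=1..n. D 1 (cos (t k)) * - sin (t k)) = - (\<Sum>k=1..n. poly q (cos (t k)) * sin (t k))"
    unfolding sum_negf[symmetric] using q(2) by (intro sum.cong) (auto simp: Z_def)
  also have "\<dots> = - (coeff q m * real n * sin (real n * \<phi>) / 2 ^ m)"
    using sum_poly_cos_sin_equally_spaced[OF q(1) n] by (simp add: t_def)
  also have "coeff q m = D n \<xi> / fact m"
    using \<xi>(2) n by (simp add: field_simps)
  finally show ?thesis
    using \<xi>(1) by (intro bexI[of _ \<xi>]) (simp_all add: mult.commute mult.left_commute)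
qed

text \<open>
  Writing \<open>v\<close> and \<open>w\<close> as \<open>e\<^sup>i\<^sup>n\<^sup>\<phi>\<close> with \<open>\<phi>\<close> in \<open>[0, \<pi>/n]\<close>, up to conjugation, this is the mean value
  theorem for the preceding derivative. The set \<open>S\<close> admits functions that are singular at \<open>1\<close>:
  with \<open>S = {-1..<1}\<close> every \<open>v \<noteq> 1\<close> on the unit circle is covered.
\<close>

theorem root_sum_diff:
  fixes D :: "nat \<Rightarrow> real \<Rightarrow> real"
  assumes n: "n > 0"
    and dD: "\<And>j x. x \<in> {-1<..<1} \<Longrightarrow> (D j has_real_derivative D (Suc j) x) (at x)"
    and cont: "continuous_on S (D 0)"
    and S: "\<And>z. cmod z = 1 \<Longrightarrow> Re (z ^ n) \<le> Re v \<Longrightarrow> Re z \<in> S"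
    and v: "cmod v = 1" and w: "cmod w = 1" and less: "Re w < Re v"
  shows "\<exists>C>0. \<exists>\<xi>\<in>{-1<..<1}. root_sum n (D 0) v - root_sum n (D 0) w = C * D n \<xi>"
proof -
  obtain m where m: "n = Suc m"
    using n by (cases n) auto
  define F where "F = (\<lambda>\<phi>. \<Sum>k=1..n. D 0 (cos (\<phi> + 2 * pi * real k / real n)))"
  define \<phi> where "\<phi> = (\<lambda>z. arccos (Re z) / real n)"
  have Re_bounds: "-1 \<le> Re z \<and> Re z \<le> 1" if "cmod z = 1" for z
    using that abs_Re_le_cmod[of z] by auto
  have n_\<phi>: "real n * \<phi> z = arccos (Re z)" for z
    using n by (simp add: \<phi>_def)
  have root_sum_F: "root_sum n (D 0) z = F (\<phi> z)" if "cmod z = 1" for z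
  proof -
    have "root_sum n (D 0) z = root_sum n (D 0) (cis (real n * \<phi> z))"
      using that Re_bounds[OF that] by (intro root_sum_cong_Re) (auto simp: n_\<phi>)
    then show ?thesis
      using root_sum_cis[OF n] by (simp add: F_def)
  qed
  have "arccos (Re v) < arccos (Re w)"
    using less Re_bounds[OF v] Re_bounds[OF w] by (intro arccos_less_arccos) auto
  then have less': "\<phi> v < \<phi> w"
    using n by (simp add: \<phi>_def divide_strict_right_mono)
  have range: "arccos (Re v) \<le> real n * x" "real n * x \<le> pi" if "\<phi> v \<le> x" "x \<le> \<phi> w" for x
  proof -
    show "arccos (Re v) \<le> real n * x"
      using mult_left_mono[OF that(1), of "real n"] n_\<phi> by simp
    have "real n * x \<le> arccos (Re w)"
      using mult_left_mono[OF that(2), of "real n"] n_\<phi> by simp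
    then show "real n * x \<le> pi"
      using arccos_ubound[of "Re w"] Re_bounds[OF w] by simp
  qed
  have sin_pos: "sin (real n * x) > 0" if "\<phi> v < x" "x < \<phi> w" for x
  proof (rule sin_gt_zero)
    have "real n * \<phi> v < real n * x" "real n * x < real n * \<phi> w"
      using that n by simp_all
    then show "0 < real n * x" "real n * x < pi"
      using arccos_lbound[of "Re v"] arccos_ubound[of "Re w"] Re_bounds[OF v] Re_bounds[OF w]
      by (simp_all add: n_\<phi>)
  qed
  have deriv: "\<exists>\<xi>\<in>{-1<..<1}. (F has_real_derivative
      - (real n * sin (real n * x) / (2 ^ m * fact m)) * D n \<xi>) (at x)"
    if "\<phi> v < x" "x < \<phi> w" for x
    unfolding F_def using sin_pos[OF that] by (intro DERIV_sum_equally_spaced[OF m] dD) auto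
  \<comment> \<open>At the end points a node may be \<open>1\<close> or \<open>-1\<close>, where \<open>D 0\<close> is only known to be continuous.\<close>
  have "\<exists>l x. \<phi> v < x \<and> x < \<phi> w \<and> DERIV F x :> l \<and> F (\<phi> w) - F (\<phi> v) = (\<phi> w - \<phi> v) * l"
  proof (rule MVT[OF less'])
    have "cos (x + 2 * pi * real k / real n) \<in> S" if "x \<in> {\<phi> v..\<phi> w}" for x k
    proof -
      define z where "z = cis (x + 2 * pi * real k / real n)"
      have "z = cis x * cis (1 * (2 * pi * real k / real n))"
        by (simp add: z_def cis_mult)
      then have "z ^ n = cis x ^ n * cis (1 * (2 * pi * real k / real n)) ^ n"
        by (simp only: power_mult_distrib)
      also have "\<dots> = cis (real n * x)"
        using cis_equally_spaced_power[OF n, of 1 k] by (simp add: Complex.DeMoivre)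
      finally have "Re (z ^ n) = cos (real n * x)"
        by simp
      also have "\<dots> \<le> cos (arccos (Re v))"
        using range[of x] that arccos_lbound[of "Re v"] Re_bounds[OF v]
        by (intro cos_monotone_0_pi_le) auto
      also have "\<dots> = Re v"
        using Re_bounds[OF v] by simp
      finally show ?thesis
        using S[of z] by (simp add: z_def)
    qed
    then show "continuous_on {\<phi> v..\<phi> w} F"
      unfolding F_def
      by (intro continuous_on_sum continuous_on_compose2[OF cont] continuous_intros) auto
    show "F differentiable (at x)" if "\<phi> v < x" "x < \<phi> w" for x
      using deriv[OF that] unfolding real_differentiable_def by blast
  qed
  then obtain l x where x: "\<phi> v < x" "x < \<phi> w" and l: "DERIV F x :> l"
    and eq: "F (\<phi> w) - F (\<phi> v) = (\<phi> w - \<phi> v) * l"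
    by blast
  define c where "c = real n * sin (real n * x) / (2 ^ m * fact m)"
  have "c > 0"
    using sin_pos[OF x] n by (simp add: c_def)
  obtain \<xi> where \<xi>: "\<xi> \<in> {-1<..<1}" "DERIV F x :> - c * D n \<xi>"
    using deriv[OF x] unfolding c_def by blast
  have "l = - c * D n \<xi>"
    using l \<xi>(2) by (rule DERIV_unique)
  then have "root_sum n (D 0) v - root_sum n (D 0) w = ((\<phi> w - \<phi> v) * c) * D n \<xi>"
    using eq root_sum_F[OF v] root_sum_F[OF w] by (simp add: algebra_simps)
  moreover have "(\<phi> w - \<phi> v) * c > 0"
    using less' \<open>c > 0\<close> by simp
  ultimately show ?thesis
    using \<xi>(1) by blast
qed

section \<open>Powers of the distances to the vertices\<close>

lemma dist_power_pos: "x > 0 \<Longrightarrow> dist_power x a = x powr a"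
  by (simp add: dist_power_def)

lemma dist_power_sqrt: "x \<ge> 0 \<Longrightarrow> dist_power (sqrt x) a = dist_power x (a / 2)"
  by (simp add: dist_power_def powr_half_sqrt[symmetric] powr_powr)

lemma DERIV_dist_power:
  assumes "x > 0"
  shows "((\<lambda>x. dist_power x a) has_real_derivative a * dist_power x (a - 1)) (at x)"
proof (rule has_field_derivative_transform_within_open[where S = "{0<..}"])
  show "((\<lambda>x. x powr a) has_real_derivative a * dist_power x (a - 1)) (at x)"
    using assms by (auto intro!: derivative_eq_intros simp: dist_power_pos)
qed (use assms in \<open>auto simp: dist_power_pos\<close>)

lemma continuous_on_dist_power:
  fixes f :: "real \<Rightarrow> real"
  assumes "continuous_on S f" and "\<And>x. x \<in> S \<Longrightarrow> f x \<ge> 0"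
    and "\<And>x. x \<in> S \<Longrightarrow> f x = 0 \<Longrightarrow> a \<ge> 0"
  shows "continuous_on S (\<lambda>x. dist_power (f x) a)"
proof (cases "a = 0")
  case True
  then show ?thesis
    by (simp add: dist_power_def)
next
  case False
  have "continuous_on S (\<lambda>x. f x powr a)"
    by (rule continuous_on_powr'[OF assms(1) continuous_on_const])
       (use assms(2,3) False in \<open>force simp: less_le\<close>)
  then show ?thesis
    using False by (simp add: dist_power_def)
qed

lemma sq_dist_pos:
  fixes \<rho> x :: real
  assumes "\<rho> > 0" and "x \<le> 1" and "\<rho> \<noteq> 1 \<or> x < 1"
  shows "1 + \<rho>\<^sup>2 - 2 * \<rho> * x > 0"
proof -
  have eq: "1 + \<rho>\<^sup>2 - 2 * \<rho> * x = (1 - \<rho>)\<^sup>2 + 2 * \<rho> * (1 - x)"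
    by (simp add: power2_eq_square algebra_simps)
  have "(1 - \<rho>)\<^sup>2 \<ge> 0" "2 * \<rho> * (1 - x) \<ge> 0"
    using assms by auto
  moreover have "(1 - \<rho>)\<^sup>2 > 0 \<or> 2 * \<rho> * (1 - x) > 0"
    using assms by auto
  ultimately show ?thesis
    unfolding eq by linarith
qed

text \<open>
  Each differentiation of \<open>(1 + \<rho>\<^sup>2 - 2 \<rho> x)\<^sup>a\<^sup>/\<^sup>2\<close> contributes the positive factor \<open>2 \<rho>\<close>, one factor
  \<open>j - a/2\<close>, and lowers the exponent of a base that is positive on \<open>(-1, 1)\<close>.
\<close>

lemma root_sum_dist_power_diff:
  fixes \<rho> a :: real
  assumes n: "n > 0" and \<rho>: "\<rho> > 0"
    and v: "cmod v = 1" and w: "cmod w = 1" and less: "Re w < Re v"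
    and regular: "a \<ge> 0 \<or> \<rho> \<noteq> 1 \<or> v \<noteq> 1"
  defines "f \<equiv> \<lambda>x. dist_power (1 + \<rho>\<^sup>2 - 2 * \<rho> * x) (a / 2)"
  shows "\<exists>C>0. root_sum n f v - root_sum n f w = C * (\<Prod>j<n. real j - a / 2)"
proof -
  define b where "b = (\<lambda>x. 1 + \<rho>\<^sup>2 - 2 * \<rho> * x)"
  define D where "D = (\<lambda>j x. (2 * \<rho>) ^ j * (\<Prod>i<j. real i - a / 2) * dist_power (b x) (a / 2 - real j))"
  have D0: "D 0 = f"
    by (simp add: D_def f_def b_def)
  have dD: "(D j has_real_derivative D (Suc j) x) (at x)" if "x \<in> {-1<..<1}" for j x
  proof -
    have "b x > 0"
      using that sq_dist_pos[OF \<rho>, of x] by (simp add: b_def)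
    moreover have "(b has_real_derivative - (2 * \<rho>)) (at x)"
      unfolding b_def by (auto intro!: derivative_eq_intros)
    ultimately have "((\<lambda>x. dist_power (b x) (a / 2 - real j)) has_real_derivative
        ((a / 2 - real j) * dist_power (b x) (a / 2 - real j - 1)) * - (2 * \<rho>)) (at x)"
      by (intro DERIV_chain2[OF DERIV_dist_power])
    from DERIV_cmult[OF this, of "(2 * \<rho>) ^ j * (\<Prod>i<j. real i - a / 2)"]
    show ?thesis
      by (simp add: D_def algebra_simps)
  qed
  define S where "S = (if a \<ge> 0 \<or> \<rho> \<noteq> 1 then {-1..1} else {-1..<1::real})"
  have "continuous_on S (D 0)"
    unfolding D0 f_def
  proof (rule continuous_on_dist_power)
    have pos: "1 + \<rho>\<^sup>2 - 2 * \<rho> * x > 0" if "x \<in> S" "\<not> (a \<ge> 0 \<and> \<rho> = 1 \<and> x = 1)" for x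
      using that by (intro sq_dist_pos[OF \<rho>]) (auto simp: S_def split: if_splits)
    show "1 + \<rho>\<^sup>2 - 2 * \<rho> * x \<ge> 0" if "x \<in> S" for x
      using pos[OF that] by fastforce
    show "a / 2 \<ge> 0" if "x \<in> S" "1 + \<rho>\<^sup>2 - 2 * \<rho> * x = 0" for x
      using pos[OF that(1)] that(2) by fastforce
  qed (intro continuous_intros)
  moreover have "Re z \<in> S" if z: "cmod z = 1" and le: "Re (z ^ n) \<le> Re v" for z
  proof -
    have bounds: "-1 \<le> Re z" "Re z \<le> 1"
      using z abs_Re_le_cmod[of z] by auto
    have "Re z \<noteq> 1" if "\<not> (a \<ge> 0 \<or> \<rho> \<noteq> 1)"
    proof
      assume "Re z = 1"
      then have "z = 1"
        using z cmod_power2[of z] by (simp add: complex_eq_iff)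
      then have "Re v \<ge> 1"
        using le by simp
      then have "v = 1"
        using v abs_Re_le_cmod[of v] cmod_power2[of v] by (simp add: complex_eq_iff)
      then show False
        using regular that by simp
    qed
    then show ?thesis
      using bounds by (auto simp: S_def)
  qed
  ultimately obtain C \<xi> where C: "C > 0" "\<xi> \<in> {-1<..<1}"
    "root_sum n (D 0) v - root_sum n (D 0) w = C * D n \<xi>"
    using root_sum_diff[where D = D, OF n dD _ _ v w less] by blast
  define K where "K = (2 * \<rho>) ^ n * dist_power (b \<xi>) (a / 2 - real n)"
  have "b \<xi> > 0"
    using C(2) sq_dist_pos[OF \<rho>, of \<xi>] by (simp add: b_def)
  then have "K > 0"
    using \<rho> by (simp add: K_def dist_power_pos)
  moreover have "D n \<xi> = K * (\<Prod>j<n. real j - a / 2)"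
    by (simp add: D_def K_def)
  ultimately show ?thesis
    using C(1,3) unfolding D0 by (intro exI[of _ "C * K"]) simp
qed

text \<open>
  The rotation taking the direction of \<open>P\<^sub>i\<close> to \<open>1\<close> takes that of \<open>X\<close> to \<open>u w\<close> for an \<open>n\<close>-th root of
  unity \<open>w\<close>, and these points \<open>u w\<close> are the \<open>n\<close>-th roots of \<open>u\<^sup>n\<close>. The rest is the law of cosines.
\<close>

lemma R_eq_root_sum:
  fixes \<rho> \<theta> \<epsilon> a :: real
  assumes n: "n > 0" and \<rho>: "\<rho> > 0" and \<epsilon>: "\<epsilon> \<in> {1, -1}"
    and P: "\<And>i. i \<in> {1..n} \<Longrightarrow> P i = c + cis (\<theta> + \<epsilon> * (2 * pi * real i / real n))"
    and u: "cmod u = 1"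
  shows "R n P a (c + of_real \<rho> * cis \<theta> * u) =
    root_sum n (\<lambda>x. dist_power (1 + \<rho>\<^sup>2 - 2 * \<rho> * x) (a / 2)) (u ^ n)"
proof -
  have "dist_power (dist (c + of_real \<rho> * cis \<theta> * u) (P i)) a =
      dist_power (1 + \<rho>\<^sup>2 - 2 * \<rho> * Re (u * cis (- \<epsilon> * (2 * pi * real i / real n)))) (a / 2)"
    if "i \<in> {1..n}" for i
  proof -
    define t where "t = \<epsilon> * (2 * pi * real i / real n)"
    have "c + of_real \<rho> * cis \<theta> * u - P i = cis \<theta> * (of_real \<rho> * u - cis t)"
      using P[OF that] by (simp add: t_def cis_mult[symmetric] algebra_simps)
    then have "(dist (c + of_real \<rho> * cis \<theta> * u) (P i))\<^sup>2 = (cmod (of_real \<rho> * u - cis t))\<^sup>2"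
      by (simp add: dist_norm norm_mult)
    also have "\<dots> = \<rho>\<^sup>2 * ((Re u)\<^sup>2 + (Im u)\<^sup>2) + ((cos t)\<^sup>2 + (sin t)\<^sup>2) - 2 * \<rho> * (Re u * cos t + Im u * sin t)"
      unfolding cmod_power2 by (simp add: power2_eq_square algebra_simps)
    also have "\<dots> = 1 + \<rho>\<^sup>2 - 2 * \<rho> * Re (u * cis (- t))"
      using u cmod_power2[of u] by simp
    finally have "dist (c + of_real \<rho> * cis \<theta> * u) (P i) = sqrt (1 + \<rho>\<^sup>2 - 2 * \<rho> * Re (u * cis (- t)))"
      "1 + \<rho>\<^sup>2 - 2 * \<rho> * Re (u * cis (- t)) \<ge> 0"
      by (metis real_sqrt_abs abs_of_nonneg zero_le_dist, metis zero_le_power2)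
    then show ?thesis
      using dist_power_sqrt by (simp add: t_def)
  qed
  then have "R n P a (c + of_real \<rho> * cis \<theta> * u) =
      (\<Sum>i=1..n. dist_power (1 + \<rho>\<^sup>2 - 2 * \<rho> * Re (u * cis (- \<epsilon> * (2 * pi * real i / real n)))) (a / 2))"
    by (simp add: R_def)
  also have "\<dots> = root_sum n (\<lambda>x. dist_power (1 + \<rho>\<^sup>2 - 2 * \<rho> * x) (a / 2)) (u ^ n)"
    using n \<epsilon> u by (intro root_sum_power[symmetric]) auto
  finally show ?thesis .
qed

lemma prod_sign:
  fixes s :: real
  assumes "k \<le> n" and "\<And>j. j < k \<Longrightarrow> real j < s" and "\<And>j. k \<le> j \<Longrightarrow> j < n \<Longrightarrow> s < real j"
  shows "0 < (-1) ^ k * (\<Prod>j<n. real j - s)"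
  using assms
proof (induction n arbitrary: k)
  case 0
  then show ?case
    by simp
next
  case (Suc n)
  show ?case
  proof (cases "k \<le> n")
    case True
    then have "0 < ((-1) ^ k * (\<Prod>j<n. real j - s)) * (real n - s)"
      by (rule mult_pos_pos[OF Suc.IH]) (use Suc.prems True in auto)
    then show ?thesis
      by (simp add: mult.assoc)
  next
    case False
    then have k: "k = Suc n"
      using Suc.prems(1) by simp
    have "0 < ((-1) ^ n * (\<Prod>j<n. real j - s)) * (s - real n)"
      by (rule mult_pos_pos[OF Suc.IH]) (use Suc.prems k in auto)
    then show ?thesis
      by (simp add: k algebra_simps)
  qed
qed

section \<open>A coordinate on the circle adapted to the polygon\<close>

lemma ray_sphere_point:
  assumes "b \<in> ray c (c + cis t) \<inter> sphere c \<rho>"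
  shows "b = c + of_real \<rho> * cis t"
proof -
  obtain s where s: "s \<ge> 0" "b = c + of_real s * cis t"
    using assms by (auto simp: ray_def)
  then have "s = \<rho>"
    using assms by (auto simp: dist_norm norm_mult)
  then show ?thesis
    using s by simp
qed

lemma cis_eq_imp_eq:
  assumes "cis x = cis y" and "\<bar>x\<bar> < pi" and "\<bar>y\<bar> < pi"
  shows "x = y"
proof -
  have "Arg (cis x) = x" "Arg (cis y) = y"
    using assms(2,3) by (auto intro!: Arg_cis)
  then show ?thesis
    using assms(1) by metis
qed

lemma vertex_successor:
  fixes \<rho> \<theta> \<epsilon> :: real
  assumes n: "n > 0" and \<epsilon>: "\<epsilon> \<in> {1, -1}" and i: "i \<in> {1..n}"
    and B: "\<And>i. i \<in> {1..n} \<Longrightarrow> B i = c + of_real \<rho> * cis (\<theta> + \<epsilon> * (2 * pi * real i / real n))"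
  shows "B (i mod n + 1) = c + of_real \<rho> * cis (\<theta> + \<epsilon> * (2 * pi * real i / real n) + \<epsilon> * (2 * pi / real n))"
proof (cases "i = n")
  case True
  have "cis (\<epsilon> * (2 * pi)) = 1"
    using \<epsilon> by (auto simp: complex_eq_iff)
  then have "cis (\<theta> + \<epsilon> * (2 * pi * real i / real n) + \<epsilon> * (2 * pi / real n)) =
      cis (\<theta> + \<epsilon> * (2 * pi * real 1 / real n))"
    using True n by (simp add: cis_mult[symmetric])
  then show ?thesis
    using True B[of 1] n by simp
next
  case False
  then have "B (i mod n + 1) = c + of_real \<rho> * cis (\<theta> + \<epsilon> * (2 * pi * real (i + 1) / real n))"
    using i B[of "i + 1"] by simp
  also have "\<theta> + \<epsilon> * (2 * pi * real (i + 1) / real n) =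
      \<theta> + \<epsilon> * (2 * pi * real i / real n) + \<epsilon> * (2 * pi / real n)"
    by (simp add: add_divide_distrib distrib_left)
  finally show ?thesis .
qed

text \<open>
  For \<open>n \<ge> 3\<close> consecutive vertices span an angle less than \<open>\<pi>\<close>, so the polar angles of the
  endpoints of a short arc differ by exactly \<open>2\<pi>/n\<close>, in the direction \<open>\<epsilon>\<close>.
\<close>

lemma bisects_iff_power:
  fixes \<rho> \<theta> \<epsilon> :: real
  assumes n: "n \<ge> 3" and \<epsilon>: "\<epsilon> \<in> {1, -1}" and \<rho>: "\<rho> > 0"
    and B: "\<And>i. i \<in> {1..n} \<Longrightarrow> B i = c + of_real \<rho> * cis (\<theta> + \<epsilon> * (2 * pi * real i / real n))"
  shows "bisects_consecutive_arc n c \<rho> B (c + of_real \<rho> * cis \<theta> * u) \<longleftrightarrow> u ^ n = -1"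
proof
  have n0: "n > 0"
    using n by simp
  have succ: "B (i mod n + 1) =
      c + of_real \<rho> * cis (\<theta> + \<epsilon> * (2 * pi * real i / real n) + \<epsilon> * (2 * pi / real n))"
    if "i \<in> {1..n}" for i
    using vertex_successor[OF n0 \<epsilon> that B] .
  have small: "\<bar>\<epsilon> * (2 * pi / real n)\<bar> < pi"
    using n \<epsilon> by (auto simp: field_simps)
  have half_power: "cis (\<epsilon> * (pi / real n)) ^ n = -1"
  proof -
    have "cis (\<epsilon> * (pi / real n)) ^ n = cis (real n * (\<epsilon> * (pi / real n)))"
      by (simp only: Complex.DeMoivre)
    also have "real n * (\<epsilon> * (pi / real n)) = \<epsilon> * pi"
      using n by simp
    finally show ?thesis
      using \<epsilon> by (auto simp: complex_eq_iff)
  qed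
  show "u ^ n = -1" if bisects: "bisects_consecutive_arc n c \<rho> B (c + of_real \<rho> * cis \<theta> * u)"
  proof -
    obtain i \<alpha> \<beta> where i: "i \<in> {1..n}" and "\<bar>\<beta> - \<alpha>\<bar> < pi"
      and "B i = c + of_real \<rho> * cis \<alpha>" and "B (i mod n + 1) = c + of_real \<rho> * cis \<beta>"
      and "c + of_real \<rho> * cis \<theta> * u = c + of_real \<rho> * cis ((\<alpha> + \<beta>) / 2)"
      using bisects unfolding bisects_consecutive_arc_def short_arc_midpoint_def by blast
    then have \<alpha>: "cis \<alpha> = cis (\<theta> + \<epsilon> * (2 * pi * real i / real n))"
      and \<beta>: "cis \<beta> = cis (\<theta> + \<epsilon> * (2 * pi * real i / real n) + \<epsilon> * (2 * pi / real n))"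
      and u: "cis \<theta> * u = cis ((\<alpha> + \<beta>) / 2)"
      using B[OF i] succ[OF i] \<rho> by auto
    have "cis \<alpha> * cis (\<beta> - \<alpha>) = cis \<alpha> * cis (\<epsilon> * (2 * pi / real n))"
      using \<beta> unfolding \<alpha> cis_mult[of "\<theta> + \<epsilon> * (2 * pi * real i / real n)" "\<epsilon> * (2 * pi / real n)"]
      by (simp add: cis_divide[symmetric] \<alpha>)
    then have "cis (\<beta> - \<alpha>) = cis (\<epsilon> * (2 * pi / real n))"
      by simp
    then have "\<beta> - \<alpha> = \<epsilon> * (2 * pi / real n)"
      using \<open>\<bar>\<beta> - \<alpha>\<bar> < pi\<close> small by (rule cis_eq_imp_eq)
    then have "(\<alpha> + \<beta>) / 2 = \<alpha> + \<epsilon> * (pi / real n)"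
      by (simp add: field_simps)
    then have "cis \<theta> * u = cis \<theta> * (cis (\<epsilon> * (2 * pi * real i / real n)) * cis (\<epsilon> * (pi / real n)))"
      using u \<alpha> by (simp only: cis_mult[symmetric] mult.assoc)
    then have "u = cis (\<epsilon> * (2 * pi * real i / real n)) * cis (\<epsilon> * (pi / real n))"
      by simp
    then show ?thesis
      using half_power cis_equally_spaced_power[OF n0 \<epsilon>, of i] by (simp only: power_mult_distrib mult_1_left)
  qed
  show "bisects_consecutive_arc n c \<rho> B (c + of_real \<rho> * cis \<theta> * u)" if "u ^ n = -1"
  proof -
    have "(u / cis (\<epsilon> * (pi / real n))) ^ n = 1"
      using that half_power by (simp only: power_divide) simp
    then have "u / cis (\<epsilon> * (pi / real n)) \<in> (\<lambda>k. cis (\<epsilon> * (2 * pi * real k / real n))) ` {1..n}"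
      using bij_betw_imp_surj_on[OF bij_betw_cis_equally_spaced[OF n0 \<epsilon>]] by simp
    then obtain i where i: "i \<in> {1..n}" "u / cis (\<epsilon> * (pi / real n)) = cis (\<epsilon> * (2 * pi * real i / real n))"
      by blast
    define \<alpha> \<beta> where "\<alpha> = \<theta> + \<epsilon> * (2 * pi * real i / real n)" and "\<beta> = \<alpha> + \<epsilon> * (2 * pi / real n)"
    have "(\<alpha> + \<beta>) / 2 = \<alpha> + \<epsilon> * (pi / real n)"
      by (simp add: \<beta>_def field_simps)
    moreover have "u = cis (\<epsilon> * (2 * pi * real i / real n)) * cis (\<epsilon> * (pi / real n))"
      using i(2) by (simp add: divide_eq_eq)
    ultimately have "cis \<theta> * u = cis ((\<alpha> + \<beta>) / 2)"
      by (simp only: \<alpha>_def cis_mult add.assoc)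
    moreover have "\<bar>\<beta> - \<alpha>\<bar> < pi"
      using small by (simp add: \<beta>_def)
    ultimately have "short_arc_midpoint c \<rho> (B i) (B (i mod n + 1)) (c + of_real \<rho> * cis \<theta> * u)"
      unfolding short_arc_midpoint_def using B[OF i(1)] succ[OF i(1)]
      by (intro exI[of _ \<alpha>] exI[of _ \<beta>]) (simp add: \<alpha>_def \<beta>_def mult.assoc)
    then show ?thesis
      using i(1) by (auto simp: bisects_consecutive_arc_def)
  qed
qed

text \<open>
  The coordinate is \<open>h X = Re (u\<^sup>n)\<close> for \<open>u = (X - c) / (\<rho> e\<^sup>i\<^sup>\<theta>)\<close>, where \<open>\<theta>\<close> is the polar
  angle of a vertex; that is, \<open>cos (n \<phi>)\<close> if \<open>\<phi>\<close> is the angle at \<open>c\<close> between \<open>X\<close> and a vertex.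
\<close>

lemma ngon_coordinate:
  fixes n :: nat and c :: complex and P B :: "nat \<Rightarrow> complex" and \<rho> a :: real
  assumes n: "n \<ge> 3"
    and P: "regular_ngon n c 1 P"
    and \<rho>: "\<rho> > 0"
    and B: "\<And>i. i \<in> {1..n} \<Longrightarrow> B i \<in> ray c (P i) \<inter> sphere c \<rho>"
  obtains h :: "complex \<Rightarrow> real"
  where "\<And>X. X \<in> sphere c \<rho> \<Longrightarrow> -1 \<le> h X \<and> h X \<le> 1"
    and "\<And>X. X \<in> sphere c \<rho> \<Longrightarrow> h X = 1 \<longleftrightarrow> (\<exists>i\<in>{1..n}. X = B i)"
    and "\<And>X. bisects_consecutive_arc n c \<rho> B X \<longleftrightarrow> X \<in> sphere c \<rho> \<and> h X = -1"
    and "\<exists>X\<in>sphere c \<rho>. h X = -1"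
    and "\<And>X Y. X \<in> sphere c \<rho> \<Longrightarrow> Y \<in> sphere c \<rho> \<Longrightarrow> h X = h Y \<Longrightarrow> R n P a X = R n P a Y"
    and "\<And>X Y. X \<in> sphere c \<rho> \<Longrightarrow> Y \<in> sphere c \<rho> \<Longrightarrow> h Y < h X \<Longrightarrow>
      a \<ge> 0 \<or> \<rho> \<noteq> 1 \<or> h X \<noteq> 1 \<Longrightarrow> \<exists>C>0. R n P a X - R n P a Y = C * (\<Prod>j<n. real j - a / 2)"
proof -
  have n0: "n > 0"
    using n by simp
  obtain \<theta> \<epsilon> where \<epsilon>: "\<epsilon> \<in> {1, -1::real}"
    and "\<forall>i\<in>{1..n}. P i = c + of_real 1 * cis (\<theta> + \<epsilon> * (2 * pi * real i / real n))"
    using P unfolding regular_ngon_def by blast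
  then have P': "P i = c + cis (\<theta> + \<epsilon> * (2 * pi * real i / real n))" if "i \<in> {1..n}" for i
    using that by simp
  have B': "B i = c + of_real \<rho> * cis (\<theta> + \<epsilon> * (2 * pi * real i / real n))" if "i \<in> {1..n}" for i
    using B[OF that] P'[OF that] ray_sphere_point by metis
  define u where "u = (\<lambda>X. (X - c) / (of_real \<rho> * cis \<theta>))"
  define v where "v = (\<lambda>X. u X ^ n)"
  define f where "f = (\<lambda>x. dist_power (1 + \<rho>\<^sup>2 - 2 * \<rho> * x) (a / 2))"
  have X_u: "X = c + of_real \<rho> * cis \<theta> * u X" for X
    using \<rho> by (simp add: u_def)
  have u_norm: "cmod (u X) = 1 \<longleftrightarrow> X \<in> sphere c \<rho>" for X
    using \<rho> by (auto simp: u_def norm_divide norm_mult dist_norm norm_minus_commute)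
  have v_norm: "cmod (v X) = 1" if "X \<in> sphere c \<rho>" for X
    using that u_norm[of X] by (simp add: v_def norm_power)
  have R_v: "R n P a X = root_sum n f (v X)" if "X \<in> sphere c \<rho>" for X
    using R_eq_root_sum[OF n0 \<rho> \<epsilon> P', of "u X" a] that u_norm[of X] X_u[of X]
    by (simp add: v_def f_def)
  have Re_1: "Re (v X) = 1 \<longleftrightarrow> v X = 1" "Re (v X) = -1 \<longleftrightarrow> v X = -1" if "X \<in> sphere c \<rho>" for X
    using v_norm[OF that] cmod_power2[of "v X"] by (auto simp: complex_eq_iff)
  have u_cis: "u (c + of_real \<rho> * cis (\<theta> + t)) = cis t" for t
    using \<rho> by (simp add: u_def cis_mult[symmetric])
  show ?thesis
  proof (rule that[of "\<lambda>X. Re (v X)"])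
    fix X Y
    assume X: "X \<in> sphere c \<rho>"
    show "-1 \<le> Re (v X) \<and> Re (v X) \<le> 1"
      using v_norm[OF X] abs_Re_le_cmod[of "v X"] by auto
    show "Re (v X) = 1 \<longleftrightarrow> (\<exists>i\<in>{1..n}. X = B i)"
    proof -
      have "v X = 1 \<longleftrightarrow> u X \<in> (\<lambda>k. cis (\<epsilon> * (2 * pi * real k / real n))) ` {1..n}"
        using bij_betw_imp_surj_on[OF bij_betw_cis_equally_spaced[OF n0 \<epsilon>]] by (simp add: v_def)
      also have "\<dots> \<longleftrightarrow> (\<exists>i\<in>{1..n}. X = B i)"
      proof -
        have "u X = cis (\<epsilon> * (2 * pi * real i / real n)) \<longleftrightarrow> X = B i" if "i \<in> {1..n}" for i
        proof
          show "X = B i" if "u X = cis (\<epsilon> * (2 * pi * real i / real n))"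
            using X_u[of X] B'[OF \<open>i \<in> {1..n}\<close>] by (simp add: that cis_mult[symmetric])
          show "u X = cis (\<epsilon> * (2 * pi * real i / real n))" if "X = B i"
            using u_cis B'[OF \<open>i \<in> {1..n}\<close>] that by simp
        qed
        then show ?thesis
          by blast
      qed
      finally show ?thesis
        using Re_1[OF X] by simp
    qed
    assume Y: "Y \<in> sphere c \<rho>"
    show "R n P a X = R n P a Y" if "Re (v X) = Re (v Y)"
      using root_sum_cong_Re[of "v X" "v Y"] v_norm[OF X] v_norm[OF Y] that
      by (simp add: R_v[OF X] R_v[OF Y])
    show "\<exists>C>0. R n P a X - R n P a Y = C * (\<Prod>j<n. real j - a / 2)"
      if "Re (v Y) < Re (v X)" "a \<ge> 0 \<or> \<rho> \<noteq> 1 \<or> Re (v X) \<noteq> 1"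
      unfolding R_v[OF X] R_v[OF Y] f_def
      by (rule root_sum_dist_power_diff[OF n0 \<rho> v_norm[OF X] v_norm[OF Y] that(1)])
         (use that(2) in auto)
  next
    fix X
    have iff: "bisects_consecutive_arc n c \<rho> B X \<longleftrightarrow> v X = -1"
      using bisects_iff_power[OF n \<epsilon> \<rho> B', of "u X"] X_u[of X] by (simp add: v_def)
    moreover have "X \<in> sphere c \<rho>" if "v X = -1"
    proof -
      have "cmod (u X) ^ n = 1"
        using that by (simp add: v_def norm_power[symmetric])
      then show ?thesis
        using u_norm power_eq_imp_eq_base[of "cmod (u X)" n 1] n0 by simp
    qed
    ultimately show "bisects_consecutive_arc n c \<rho> B X \<longleftrightarrow> X \<in> sphere c \<rho> \<and> Re (v X) = -1"
      using Re_1 by blast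
  next
    define X where "X = c + of_real \<rho> * cis (\<theta> + pi / real n)"
    have "v X = cis (real n * (pi / real n))"
      unfolding v_def X_def u_cis by (simp only: Complex.DeMoivre)
    also have "real n * (pi / real n) = pi"
      using n by simp
    finally have "Re (v X) = -1"
      by simp
    moreover have "X \<in> sphere c \<rho>"
      using u_norm[of X] u_cis by (simp add: X_def)
    ultimately show "\<exists>X\<in>sphere c \<rho>. Re (v X) = -1"
      by blast
  qed
qed

section \<open>Extrema and singularities\<close>

lemma is_arg_extremum_cong_order:
  fixes f :: "'a \<Rightarrow> 'b::order" and g :: "'a \<Rightarrow> 'c::order"
  assumes "\<And>x y. x \<in> S \<Longrightarrow> y \<in> S \<Longrightarrow> f x < f y \<longleftrightarrow> g x < g y"
  shows "is_arg_max f (\<lambda>y. y \<in> S) x \<longleftrightarrow> is_arg_max g (\<lambda>y. y \<in> S) x"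
    and "is_arg_min f (\<lambda>y. y \<in> S) x \<longleftrightarrow> is_arg_min g (\<lambda>y. y \<in> S) x"
  using assms by (auto simp: is_arg_max_def is_arg_min_def)

lemma is_arg_extremum_cong_dual_order:
  fixes f :: "'a \<Rightarrow> 'b::order" and g :: "'a \<Rightarrow> 'c::order"
  assumes "\<And>x y. x \<in> S \<Longrightarrow> y \<in> S \<Longrightarrow> f x < f y \<longleftrightarrow> g y < g x"
  shows "is_arg_max f (\<lambda>y. y \<in> S) x \<longleftrightarrow> is_arg_min g (\<lambda>y. y \<in> S) x"
    and "is_arg_min f (\<lambda>y. y \<in> S) x \<longleftrightarrow> is_arg_max g (\<lambda>y. y \<in> S) x"
  using assms by (auto simp: is_arg_max_def is_arg_min_def)

lemma filterlim_powr_at_right_0: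
  fixes a :: real
  assumes "a < 0"
  shows "filterlim (\<lambda>x. x powr a) at_top (at_right 0)"
proof -
  have "filterlim (\<lambda>x::real. - ln x) at_top (at_right 0)"
    using ln_at_0 by (simp add: filterlim_uminus_at_bot)
  then have "filterlim (\<lambda>x. - a * - ln x) at_top (at_right 0)"
    using assms by (intro filterlim_tendsto_pos_mult_at_top[OF tendsto_const]) auto
  then have "filterlim (\<lambda>x. exp (a * ln x)) at_top (at_right 0)"
    using filterlim_compose[OF exp_at_top] by simp
  moreover have "eventually (\<lambda>x. exp (a * ln x) \<le> x powr a) (at_right (0::real))"
    using eventually_at_right_less by (rule eventually_mono) (simp add: powr_def)
  ultimately show ?thesis
    by (rule filterlim_at_top_mono)
qed

lemma filterlim_R_at_vertex:
  assumes "a < 0" and "i \<in> {1..n}"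
  shows "filterlim (R n P a) at_top (at (P i) within S)"
proof (rule filterlim_at_top_mono)
  have "filterlim (\<lambda>X. dist X (P i)) (at_right 0) (at (P i) within S)"
    unfolding filterlim_at
  proof
    show "eventually (\<lambda>X. dist X (P i) \<in> {0<..} \<and> dist X (P i) \<noteq> 0) (at (P i) within S)"
      by (auto simp: eventually_at_filter)
    have "((\<lambda>X. dist X (P i)) \<longlongrightarrow> dist (P i) (P i)) (at (P i) within S)"
      by (intro tendsto_intros)
    then show "((\<lambda>X. dist X (P i)) \<longlongrightarrow> 0) (at (P i) within S)"
      by simp
  qed
  then show "filterlim (\<lambda>X. dist X (P i) powr a) at_top (at (P i) within S)"
    by (rule filterlim_compose[OF filterlim_powr_at_right_0[OF assms(1)]])
  have "dist_power (dist X (P i)) a \<le> R n P a X" for X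
    unfolding R_def using assms(2) by (intro member_le_sum) (auto simp: dist_power_def)
  then show "eventually (\<lambda>X. dist X (P i) powr a \<le> R n P a X) (at (P i) within S)"
    using assms(1) by (simp add: dist_power_def)
qed

lemma islimpt_sphere_minus_finite:
  fixes p c :: complex
  assumes "p \<in> sphere c r" and "r > 0" and "finite F"
  shows "p islimpt sphere c r - F"
proof -
  have "p islimpt sphere c r"
  proof (rule connected_imp_perfect)
    show "connected (sphere c r)"
      by (intro connected_sphere) simp
    have "c + of_real r \<in> sphere c r" "c - of_real r \<in> sphere c r"
      using assms(2) by (auto simp: dist_norm)
    moreover have "c + of_real r \<noteq> c - of_real r"
      using assms(2) by (simp add: complex_eq_iff)
    ultimately show "sphere c r \<noteq> {x}" for x
      by (metis singletonD)
  qed (rule assms(1))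
  moreover have "sphere c r = (sphere c r - F) \<union> (sphere c r \<inter> F)"
    by blast
  ultimately have "p islimpt sphere c r - F \<or> p islimpt sphere c r \<inter> F"
    by (metis islimpt_Un)
  then show ?thesis
    using assms(3) islimpt_finite by blast
qed

lemma not_bdd_above_if_filterlim_at_top:
  fixes f :: "'a::t1_space \<Rightarrow> real"
  assumes "filterlim f at_top (at p within S)" and "p islimpt S"
  shows "\<not> bdd_above (f ` S)"
proof
  assume "bdd_above (f ` S)"
  then obtain M where M: "\<And>x. x \<in> S \<Longrightarrow> f x \<le> M"
    by (auto simp: bdd_above_def)
  have "eventually (\<lambda>x. M < f x) (at p within S)"
    using assms(1) by (simp add: filterlim_at_top_dense)
  moreover have "eventually (\<lambda>x. x \<in> S) (at p within S)"
    by (simp add: eventually_at_filter)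
  ultimately have "eventually (\<lambda>x. False) (at p within S)"
    by eventually_elim (use M in force)
  then show False
    using assms(2) by (simp add: trivial_limit_within)
qed

theorem theorem2:
  fixes n :: nat and c :: complex and P B :: "nat \<Rightarrow> complex" and \<rho> a :: real
    and \<Gamma> :: "complex set"
  assumes n: "n \<ge> 3"
    and P: "regular_ngon n c 1 P"
    and \<rho>: "\<rho> > 0"
    and \<Gamma>: "\<Gamma> = sphere c \<rho>"
    and B: "\<And>i. i \<in> {1..n} \<Longrightarrow> B i \<in> ray c (P i) \<inter> \<Gamma>"
  shows
    "(a < 0 \<longrightarrow>
        (\<rho> \<noteq> 1 \<longrightarrow>
          (\<forall>X. bisects_consecutive_arc n c \<rho> B X \<longrightarrow> is_arg_min (R n P a) (\<lambda>Y. Y \<in> \<Gamma>) X) \<and>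
          (\<forall>i\<in>{1..n}. is_arg_max (R n P a) (\<lambda>Y. Y \<in> \<Gamma>) (B i))) \<and>
        (\<rho> = 1 \<longrightarrow>
          (\<forall>X. bisects_consecutive_arc n c \<rho> B X \<longrightarrow>
             is_arg_min (R n P a) (\<lambda>Y. Y \<in> \<Gamma> - P ` {1..n}) X) \<and>
          \<not> bdd_above (R n P a ` (\<Gamma> - P ` {1..n})) \<and>
          (\<forall>i\<in>{1..n}. filterlim (R n P a) at_top (at (B i) within \<Gamma> - P ` {1..n}))))
     \<and>
     (0 \<le> a \<and> a < 2 * real n \<longrightarrow>
        ((\<exists>k::int. even k \<and> a = of_int k) \<longrightarrow> (\<forall>X\<in>\<Gamma>. \<forall>Y\<in>\<Gamma>. R n P a X = R n P a Y)) \<and>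
        (\<not> (\<exists>k::int. even k \<and> a = of_int k) \<longrightarrow>
          (\<forall>m::int. 2 * of_int m \<le> a \<and> a \<le> 2 * of_int m + 2 \<longrightarrow>
            (even m \<longrightarrow>
              (\<forall>X\<in>\<Gamma>.
                (is_arg_max (R n P a) (\<lambda>Y. Y \<in> \<Gamma>) X \<longleftrightarrow> bisects_consecutive_arc n c \<rho> B X) \<and>
                (is_arg_min (R n P a) (\<lambda>Y. Y \<in> \<Gamma>) X \<longleftrightarrow> (\<exists>i\<in>{1..n}. X = B i)))) \<and>
            (odd m \<longrightarrow>
              (\<forall>X\<in>\<Gamma>.
                (is_arg_min (R n P a) (\<lambda>Y. Y \<in> \<Gamma>) X \<longleftrightarrow> bisects_consecutive_arc n c \<rho> B X) \<and>
                (is_arg_max (R n P a) (\<lambda>Y. Y \<in> \<Gamma>) X \<longleftrightarrow> (\<exists>i\<in>{1..n}. X = B i)))))))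
     \<and>
     (a \<ge> 2 * real n \<longrightarrow>
        (even n \<longrightarrow>
          (\<forall>i\<in>{1..n}. is_arg_max (R n P a) (\<lambda>Y. Y \<in> \<Gamma>) (B i)) \<and>
          (\<forall>X. bisects_consecutive_arc n c \<rho> B X \<longrightarrow> is_arg_min (R n P a) (\<lambda>Y. Y \<in> \<Gamma>) X)) \<and>
        (odd n \<longrightarrow>
          (\<forall>i\<in>{1..n}. is_arg_min (R n P a) (\<lambda>Y. Y \<in> \<Gamma>) (B i)) \<and>
          (\<forall>X. bisects_consecutive_arc n c \<rho> B X \<longrightarrow> is_arg_max (R n P a) (\<lambda>Y. Y \<in> \<Gamma>) X)))"
proof (rule ngon_coordinate[OF n P \<rho> B[unfolded \<Gamma>], where a = a, folded \<Gamma>])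
  fix h :: "complex \<Rightarrow> real"
  assume h_bounds: "\<And>X. X \<in> \<Gamma> \<Longrightarrow> -1 \<le> h X \<and> h X \<le> 1"
    and h_top: "\<And>X. X \<in> \<Gamma> \<Longrightarrow> h X = 1 \<longleftrightarrow> (\<exists>i\<in>{1..n}. X = B i)"
    and h_bottom: "\<And>X. bisects_consecutive_arc n c \<rho> B X \<longleftrightarrow> X \<in> \<Gamma> \<and> h X = -1"
    and bottom_ex: "\<exists>X\<in>\<Gamma>. h X = -1"
    and R_eq: "\<And>X Y. X \<in> \<Gamma> \<Longrightarrow> Y \<in> \<Gamma> \<Longrightarrow> h X = h Y \<Longrightarrow> R n P a X = R n P a Y"
    and R_diff: "\<And>X Y. X \<in> \<Gamma> \<Longrightarrow> Y \<in> \<Gamma> \<Longrightarrow> h Y < h X \<Longrightarrow>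
      a \<ge> 0 \<or> \<rho> \<noteq> 1 \<or> h X \<noteq> 1 \<Longrightarrow> \<exists>C>0. R n P a X - R n P a Y = C * (\<Prod>j<n. real j - a / 2)"
  \<comment> \<open>The sign of the \<open>n\<close>-th derivative of \<open>(1 + \<rho>\<^sup>2 - 2 \<rho> x)\<^sup>a\<^sup>/\<^sup>2\<close> on \<open>(-1, 1)\<close>.\<close>
  define \<kappa> where "\<kappa> = (\<Prod>j<n. real j - a / 2)"
  have B_in: "B i \<in> \<Gamma>" if "i \<in> {1..n}" for i
    using B[OF that] by simp
  have h_B: "h (B i) = 1" if "i \<in> {1..n}" for i
    using h_top[OF B_in[OF that]] that by blast
  have max_h: "is_arg_max h (\<lambda>Y. Y \<in> \<Gamma>) X \<longleftrightarrow> X \<in> \<Gamma> \<and> h X = 1" for X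
  proof
    have "B 1 \<in> \<Gamma>" "h (B 1) = 1"
      using B_in[of 1] h_B[of 1] n by auto
    moreover assume "is_arg_max h (\<lambda>Y. Y \<in> \<Gamma>) X"
    ultimately have "X \<in> \<Gamma>" "1 \<le> h X"
      by (auto simp: is_arg_max_def not_less)
    then show "X \<in> \<Gamma> \<and> h X = 1"
      using h_bounds[of X] by simp
  next
    assume "X \<in> \<Gamma> \<and> h X = 1"
    then show "is_arg_max h (\<lambda>Y. Y \<in> \<Gamma>) X"
      using h_bounds by (auto simp: is_arg_max_def not_less)
  qed
  have min_h: "is_arg_min h (\<lambda>Y. Y \<in> \<Gamma>) X \<longleftrightarrow> X \<in> \<Gamma> \<and> h X = -1" for X
  proof
    obtain Y where "Y \<in> \<Gamma>" "h Y = -1"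
      using bottom_ex by blast
    moreover assume "is_arg_min h (\<lambda>Y. Y \<in> \<Gamma>) X"
    ultimately have "X \<in> \<Gamma>" "h X \<le> -1"
      by (auto simp: is_arg_min_def not_less)
    then show "X \<in> \<Gamma> \<and> h X = -1"
      using h_bounds[of X] by simp
  next
    assume "X \<in> \<Gamma> \<and> h X = -1"
    then show "is_arg_min h (\<lambda>Y. Y \<in> \<Gamma>) X"
      using h_bounds by (auto simp: is_arg_min_def not_less)
  qed
  have increasing: "R n P a X < R n P a Y \<longleftrightarrow> h X < h Y"
    if "\<kappa> > 0" "X \<in> \<Gamma>" "Y \<in> \<Gamma>" "a \<ge> 0 \<or> \<rho> \<noteq> 1 \<or> h X \<noteq> 1 \<and> h Y \<noteq> 1" for X Y
  proof -
    have less: "R n P a V < R n P a W"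
      if "V \<in> \<Gamma>" "W \<in> \<Gamma>" "h V < h W" "a \<ge> 0 \<or> \<rho> \<noteq> 1 \<or> h W \<noteq> 1" for V W
    proof -
      from R_diff[OF that(2,1,3,4)] obtain C where "C > 0" "R n P a W - R n P a V = C * \<kappa>"
        by (auto simp: \<kappa>_def)
      then show ?thesis
        using mult_pos_pos[OF \<open>C > 0\<close> \<open>\<kappa> > 0\<close>] by linarith
    qed
    show ?thesis
      using less[of X Y] less[of Y X] R_eq[of X Y] that by (cases "h X" "h Y" rule: linorder_cases) auto
  qed
  have decreasing: "R n P a X < R n P a Y \<longleftrightarrow> h Y < h X"
    if "\<kappa> < 0" "X \<in> \<Gamma>" "Y \<in> \<Gamma>" "a \<ge> 0" for X Y
  proof -
    have less: "R n P a W < R n P a V" if "V \<in> \<Gamma>" "W \<in> \<Gamma>" "h V < h W" for V W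
    proof -
      from R_diff[OF that(2,1,3)] \<open>a \<ge> 0\<close> obtain C where "C > 0" "R n P a W - R n P a V = C * \<kappa>"
        by (auto simp: \<kappa>_def)
      then show ?thesis
        using mult_pos_neg[OF \<open>C > 0\<close> \<open>\<kappa> < 0\<close>] by linarith
    qed
    show ?thesis
      using less[of X Y] less[of Y X] R_eq[of X Y] that by (cases "h X" "h Y" rule: linorder_cases) auto
  qed
  have extrema_increasing:
      "is_arg_max (R n P a) (\<lambda>Y. Y \<in> \<Gamma>) X \<longleftrightarrow> (\<exists>i\<in>{1..n}. X = B i)" (is "?max_vertex")
      "is_arg_min (R n P a) (\<lambda>Y. Y \<in> \<Gamma>) X \<longleftrightarrow> bisects_consecutive_arc n c \<rho> B X" (is "?min_bisector")
    if "\<kappa> > 0" "a \<ge> 0 \<or> \<rho> \<noteq> 1" for X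
  proof -
    have order: "R n P a Y < R n P a Z \<longleftrightarrow> h Y < h Z" if "Y \<in> \<Gamma>" "Z \<in> \<Gamma>" for Y Z
      using increasing \<open>\<kappa> > 0\<close> \<open>a \<ge> 0 \<or> \<rho> \<noteq> 1\<close> that by blast
    have "is_arg_max (R n P a) (\<lambda>Y. Y \<in> \<Gamma>) X \<longleftrightarrow> is_arg_max h (\<lambda>Y. Y \<in> \<Gamma>) X"
      by (intro is_arg_extremum_cong_order order)
    then show ?max_vertex
      unfolding max_h using h_top B_in by blast
    have "is_arg_min (R n P a) (\<lambda>Y. Y \<in> \<Gamma>) X \<longleftrightarrow> is_arg_min h (\<lambda>Y. Y \<in> \<Gamma>) X"
      by (intro is_arg_extremum_cong_order order)
    then show ?min_bisector
      unfolding min_h h_bottom .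
  qed
  have extrema_decreasing:
      "is_arg_min (R n P a) (\<lambda>Y. Y \<in> \<Gamma>) X \<longleftrightarrow> (\<exists>i\<in>{1..n}. X = B i)" (is "?min_vertex")
      "is_arg_max (R n P a) (\<lambda>Y. Y \<in> \<Gamma>) X \<longleftrightarrow> bisects_consecutive_arc n c \<rho> B X" (is "?max_bisector")
    if "\<kappa> < 0" "a \<ge> 0" for X
  proof -
    have order: "R n P a Y < R n P a Z \<longleftrightarrow> h Z < h Y" if "Y \<in> \<Gamma>" "Z \<in> \<Gamma>" for Y Z
      using decreasing \<open>\<kappa> < 0\<close> \<open>a \<ge> 0\<close> that by blast
    have "is_arg_min (R n P a) (\<lambda>Y. Y \<in> \<Gamma>) X \<longleftrightarrow> is_arg_max h (\<lambda>Y. Y \<in> \<Gamma>) X"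
      by (intro is_arg_extremum_cong_dual_order order)
    then show ?min_vertex
      unfolding max_h using h_top B_in by blast
    have "is_arg_max (R n P a) (\<lambda>Y. Y \<in> \<Gamma>) X \<longleftrightarrow> is_arg_min h (\<lambda>Y. Y \<in> \<Gamma>) X"
      by (intro is_arg_extremum_cong_dual_order order)
    then show ?max_bisector
      unfolding min_h h_bottom .
  qed
  show ?thesis
  proof (intro conjI)
    show "a < 0 \<longrightarrow>
        (\<rho> \<noteq> 1 \<longrightarrow>
          (\<forall>X. bisects_consecutive_arc n c \<rho> B X \<longrightarrow> is_arg_min (R n P a) (\<lambda>Y. Y \<in> \<Gamma>) X) \<and>
          (\<forall>i\<in>{1..n}. is_arg_max (R n P a) (\<lambda>Y. Y \<in> \<Gamma>) (B i))) \<and>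
        (\<rho> = 1 \<longrightarrow>
          (\<forall>X. bisects_consecutive_arc n c \<rho> B X \<longrightarrow>
             is_arg_min (R n P a) (\<lambda>Y. Y \<in> \<Gamma> - P ` {1..n}) X) \<and>
          \<not> bdd_above (R n P a ` (\<Gamma> - P ` {1..n})) \<and>
          (\<forall>i\<in>{1..n}. filterlim (R n P a) at_top (at (B i) within \<Gamma> - P ` {1..n})))"
    proof (intro impI)
      assume a: "a < 0"
      \<comment> \<open>All factors of \<open>\<kappa>\<close> are positive.\<close>
      then have \<kappa>: "\<kappa> > 0"
        using prod_sign[of 0 n "a / 2"] by (simp add: \<kappa>_def)
      have part_regular: "(\<forall>X. bisects_consecutive_arc n c \<rho> B X \<longrightarrow> is_arg_min (R n P a) (\<lambda>Y. Y \<in> \<Gamma>) X) \<and>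
          (\<forall>i\<in>{1..n}. is_arg_max (R n P a) (\<lambda>Y. Y \<in> \<Gamma>) (B i))" if "\<rho> \<noteq> 1"
        using extrema_increasing[OF \<kappa>] that by blast
      have part_singular: "(\<forall>X. bisects_consecutive_arc n c \<rho> B X \<longrightarrow>
             is_arg_min (R n P a) (\<lambda>Y. Y \<in> \<Gamma> - P ` {1..n}) X) \<and>
          \<not> bdd_above (R n P a ` (\<Gamma> - P ` {1..n})) \<and>
          (\<forall>i\<in>{1..n}. filterlim (R n P a) at_top (at (B i) within \<Gamma> - P ` {1..n}))" if "\<rho> = 1"
      proof -
        have B_P: "B i = P i" if "i \<in> {1..n}" for i
        proof -
          obtain t where "P i = c + cis t"
            using P \<open>i \<in> {1..n}\<close> by (auto simp: regular_ngon_def)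
          then show ?thesis
            using ray_sphere_point[of "B i" c t \<rho>] B[OF \<open>i \<in> {1..n}\<close>] \<open>\<rho> = 1\<close> \<Gamma> by simp
        qed
        let ?S = "\<Gamma> - P ` {1..n}"
        have not_vertex: "h Y \<noteq> 1 \<longleftrightarrow> Y \<notin> P ` {1..n}" if "Y \<in> \<Gamma>" for Y
          using h_top[OF that] B_P by auto
        have order: "R n P a Y < R n P a Z \<longleftrightarrow> h Y < h Z" if "Y \<in> ?S" "Z \<in> ?S" for Y Z
          using increasing[OF \<kappa>, of Y Z] not_vertex that by blast
        have bisector_min: "is_arg_min (R n P a) (\<lambda>Y. Y \<in> ?S) X" if "bisects_consecutive_arc n c \<rho> B X" for X
        proof -
          have "X \<in> \<Gamma>" "h X = -1"
            using that h_bottom by auto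
          then have "X \<in> ?S"
            using not_vertex[of X] by simp
          then have "is_arg_min h (\<lambda>Y. Y \<in> ?S) X"
            using \<open>h X = -1\<close> h_bounds by (force simp: is_arg_min_def)
          then show ?thesis
            by (subst is_arg_extremum_cong_order(2)[of ?S "R n P a" h]) (use order in auto)
        qed
        have lim: "filterlim (R n P a) at_top (at (B i) within ?S)" if "i \<in> {1..n}" for i
          unfolding B_P[OF that] using a that by (rule filterlim_R_at_vertex)
        have unbounded: "\<not> bdd_above (R n P a ` ?S)"
        proof (rule not_bdd_above_if_filterlim_at_top)
          show "filterlim (R n P a) at_top (at (B 1) within ?S)"
            using n by (intro lim) simp
          show "B 1 islimpt ?S"
            using B_in[of 1] n \<rho> unfolding \<Gamma> by (intro islimpt_sphere_minus_finite) auto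
        qed
        show ?thesis
          by (intro conjI allI ballI impI bisector_min lim unbounded)
      qed
      show "(\<rho> \<noteq> 1 \<longrightarrow>
          (\<forall>X. bisects_consecutive_arc n c \<rho> B X \<longrightarrow> is_arg_min (R n P a) (\<lambda>Y. Y \<in> \<Gamma>) X) \<and>
          (\<forall>i\<in>{1..n}. is_arg_max (R n P a) (\<lambda>Y. Y \<in> \<Gamma>) (B i))) \<and>
        (\<rho> = 1 \<longrightarrow>
          (\<forall>X. bisects_consecutive_arc n c \<rho> B X \<longrightarrow>
             is_arg_min (R n P a) (\<lambda>Y. Y \<in> \<Gamma> - P ` {1..n}) X) \<and>
          \<not> bdd_above (R n P a ` (\<Gamma> - P ` {1..n})) \<and>
          (\<forall>i\<in>{1..n}. filterlim (R n P a) at_top (at (B i) within \<Gamma> - P ` {1..n})))"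
        using part_regular part_singular by blast
    qed
  next
    show "0 \<le> a \<and> a < 2 * real n \<longrightarrow>
        ((\<exists>k::int. even k \<and> a = of_int k) \<longrightarrow> (\<forall>X\<in>\<Gamma>. \<forall>Y\<in>\<Gamma>. R n P a X = R n P a Y)) \<and>
        (\<not> (\<exists>k::int. even k \<and> a = of_int k) \<longrightarrow>
          (\<forall>m::int. 2 * of_int m \<le> a \<and> a \<le> 2 * of_int m + 2 \<longrightarrow>
            (even m \<longrightarrow>
              (\<forall>X\<in>\<Gamma>.
                (is_arg_max (R n P a) (\<lambda>Y. Y \<in> \<Gamma>) X \<longleftrightarrow> bisects_consecutive_arc n c \<rho> B X) \<and>
                (is_arg_min (R n P a) (\<lambda>Y. Y \<in> \<Gamma>) X \<longleftrightarrow> (\<exists>i\<in>{1..n}. X = B i)))) \<and>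
            (odd m \<longrightarrow>
              (\<forall>X\<in>\<Gamma>.
                (is_arg_min (R n P a) (\<lambda>Y. Y \<in> \<Gamma>) X \<longleftrightarrow> bisects_consecutive_arc n c \<rho> B X) \<and>
                (is_arg_max (R n P a) (\<lambda>Y. Y \<in> \<Gamma>) X \<longleftrightarrow> (\<exists>i\<in>{1..n}. X = B i))))))"
    proof (intro impI conjI allI)
      assume a: "0 \<le> a \<and> a < 2 * real n" and "\<exists>k::int. even k \<and> a = of_int k"
      then obtain l :: int where l: "a = of_int (2 * l)"
        by (auto elim!: evenE)
      \<comment> \<open>Here \<open>a/2\<close> is one of \<open>0, \<dots>, n - 1\<close>, so that a factor of \<open>\<kappa>\<close> vanishes.\<close>
      with a have "nat l < n" "real (nat l) - a / 2 = 0"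
        by auto
      then have "\<kappa> = 0"
        unfolding \<kappa>_def by (intro prod_zero) auto
      have const: "R n P a X = R n P a Y" if "X \<in> \<Gamma>" "Y \<in> \<Gamma>" "h Y < h X" for X Y
      proof -
        have "\<exists>C>0. R n P a X - R n P a Y = C * \<kappa>"
          unfolding \<kappa>_def using R_diff[OF that] a by blast
        then show ?thesis
          using \<open>\<kappa> = 0\<close> by auto
      qed
      show "\<forall>X\<in>\<Gamma>. \<forall>Y\<in>\<Gamma>. R n P a X = R n P a Y"
        using const R_eq by (metis linorder_neqE_linordered_idom)
    next
      fix m :: int
      assume a: "0 \<le> a \<and> a < 2 * real n" and not_even: "\<not> (\<exists>k::int. even k \<and> a = of_int k)"
        and m: "2 * of_int m \<le> a \<and> a \<le> 2 * of_int m + 2"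
      have "a \<noteq> of_int (2 * m)" "a \<noteq> of_int (2 * m + 2)"
        using not_even by (metis dvd_triv_left, metis dvd_add_right_iff dvd_refl dvd_triv_left)
      then have strict: "2 * of_int m < a" "a < 2 * of_int m + 2"
        using m by auto
      then have "0 \<le> m" "m < int n"
        using a by linarith+
      then obtain p where p: "m = int p" "p < n"
        using zero_le_imp_eq_int by auto
      \<comment> \<open>The factors \<open>j - a/2\<close> with \<open>j \<le> m\<close> are negative, the others positive.\<close>
      have sign: "0 < (-1) ^ Suc p * \<kappa>"
        unfolding \<kappa>_def
      proof (rule prod_sign)
        show "Suc p \<le> n"
          using p by simp
        show "real j < a / 2" if "j < Suc p" for j
          using that strict(1) p(1) by simp
        show "a / 2 < real j" if "Suc p \<le> j" for j
          using that strict(2) p(1) by simp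
      qed
      show "\<forall>X\<in>\<Gamma>.
          (is_arg_max (R n P a) (\<lambda>Y. Y \<in> \<Gamma>) X \<longleftrightarrow> bisects_consecutive_arc n c \<rho> B X) \<and>
          (is_arg_min (R n P a) (\<lambda>Y. Y \<in> \<Gamma>) X \<longleftrightarrow> (\<exists>i\<in>{1..n}. X = B i))" if "even m"
        using extrema_decreasing sign that p(1) a by simp
      show "\<forall>X\<in>\<Gamma>.
          (is_arg_min (R n P a) (\<lambda>Y. Y \<in> \<Gamma>) X \<longleftrightarrow> bisects_consecutive_arc n c \<rho> B X) \<and>
          (is_arg_max (R n P a) (\<lambda>Y. Y \<in> \<Gamma>) X \<longleftrightarrow> (\<exists>i\<in>{1..n}. X = B i))" if "odd m"
        using extrema_increasing sign that p(1) a by simp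
    qed
  next
    show "a \<ge> 2 * real n \<longrightarrow>
        (even n \<longrightarrow>
          (\<forall>i\<in>{1..n}. is_arg_max (R n P a) (\<lambda>Y. Y \<in> \<Gamma>) (B i)) \<and>
          (\<forall>X. bisects_consecutive_arc n c \<rho> B X \<longrightarrow> is_arg_min (R n P a) (\<lambda>Y. Y \<in> \<Gamma>) X)) \<and>
        (odd n \<longrightarrow>
          (\<forall>i\<in>{1..n}. is_arg_min (R n P a) (\<lambda>Y. Y \<in> \<Gamma>) (B i)) \<and>
          (\<forall>X. bisects_consecutive_arc n c \<rho> B X \<longrightarrow> is_arg_max (R n P a) (\<lambda>Y. Y \<in> \<Gamma>) X))"
    proof (rule impI)
      assume a: "a \<ge> 2 * real n"
      then have "a \<ge> 0"
        by linarith
      have sign: "0 < (-1) ^ n * \<kappa>"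
        unfolding \<kappa>_def using a by (intro prod_sign) auto
      have "\<kappa> > 0" if "even n"
        using sign that by simp
      moreover have "\<kappa> < 0" if "odd n"
        using sign that by simp
      ultimately show "(even n \<longrightarrow>
          (\<forall>i\<in>{1..n}. is_arg_max (R n P a) (\<lambda>Y. Y \<in> \<Gamma>) (B i)) \<and>
          (\<forall>X. bisects_consecutive_arc n c \<rho> B X \<longrightarrow> is_arg_min (R n P a) (\<lambda>Y. Y \<in> \<Gamma>) X)) \<and>
        (odd n \<longrightarrow>
          (\<forall>i\<in>{1..n}. is_arg_min (R n P a) (\<lambda>Y. Y \<in> \<Gamma>) (B i)) \<and>
          (\<forall>X. bisects_consecutive_arc n c \<rho> B X \<longrightarrow> is_arg_max (R n P a) (\<lambda>Y. Y \<in> \<Gamma>) X))"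
        using extrema_increasing extrema_decreasing \<open>a \<ge> 0\<close> by blast
    qed
  qed
qed

end
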